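(* Let $a,t$ be positive integers such that $t^2\ge 9a$, and let $x$ be the unique real solution of the equation $3x^3-3tx^2-3ax+at=0$ that satisfies $x>\frac{t}{2}$. Define $$c_1:=\frac{1}{\sqrt{3}\,e}\exp\Big(-\sum_{p \text{ prime},\ p\ge 5}\frac{\ln p}{p(p-1)}\Big),\qquad \tau_3:=\frac{4(3t^2+a)}{\sqrt{\pi}},\qquad \tau_4:=\frac{105\sqrt{3}\,e^2a^4}{2\sqrt{\pi}\,t(t^2+2a)(3t^2+a)},$$ $$c_6:=\frac{144(t^2+a)^3}{c_1^2e^2},\qquad c_7:=\frac{c_1^2e^2t^4(t^2+2a)^2}{9a^6(t^2+a)}.$$ Assume that $c_7>e$. Then for every positive integer $q\ge \frac{c_7}{2\tau_4}$ one has $$\|qx\| > \frac{(\log c_7)^{1/2}}{6\tau_3c_6^2\,(2\tau_4)^{\frac{\log c_6}{\log c_7}}}\cdot q^{-\frac{\log c_6}{\log c_7}}\cdot \big(\log(2\tau_4 q)\big)^{-\frac{\log c_6}{\log c_7}-\frac12}.$$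
   Context: For a real number $y$, $\|y\|$ denotes the distance from $y$ to the nearest integer. $\log$ and $\ln$ denote the natural logarithm; $e$ is Euler's number. *)

theory Defs
  imports "HOL-Analysis.Analysis" "HOL-Computational_Algebra.Primes"
begin

definition dist_nearest_int :: "real \<Rightarrow> real" where
  "dist_nearest_int y = \<bar>y - of_int (round y)\<bar>"

lemma dist_nearest_int_eq_infdist: "dist_nearest_int y = infdist y \<int>"
proof (rule antisym)
  have "\<bar>y - of_int (round y)\<bar> \<le> dist y z" if "z \<in> \<int>" for z
    using that round_diff_minimal[of y] by (auto simp: dist_real_def elim!: Ints_cases)
  then show "dist_nearest_int y \<le> infdist y \<int>"
    unfolding dist_nearest_int_def infdist_def by (auto intro!: cINF_greatest)
  show "infdist y \<int> \<le> dist_nearest_int y"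
    using infdist_le[of "of_int (round y)" \<int> y]
    by (simp add: dist_nearest_int_def dist_real_def)
qed

(* Existence and uniqueness of the root that the theorem is about. *)
lemma ex1_cubic_root:
  fixes a t :: real
  assumes "a > 0" "t > 0"
  shows "\<exists>!x. 3 * x ^ 3 - 3 * t * x\<^sup>2 - 3 * a * x + a * t = 0 \<and> x > t / 2"
proof -
  define f where "f = (\<lambda>x::real. 3 * x ^ 3 - 3 * t * x\<^sup>2 - 3 * a * x + a * t)"
  let ?b = "t + a + 1"
  have lo: "f (t / 2) < 0"
  proof -
    have "f (t / 2) = - (3 * t ^ 3 / 8 + a * t / 2)"
      by (simp add: f_def power2_eq_square power3_eq_cube field_simps)
    moreover have "3 * t ^ 3 / 8 + a * t / 2 > 0"
      using assms by (simp add: add_pos_pos)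
    ultimately show ?thesis by linarith
  qed
  have hi: "f ?b \<ge> 0"
  proof -
    have "f ?b = 3 * ?b * (?b * (a + 1) - a) + a * t"
      by (simp add: f_def power2_eq_square power3_eq_cube algebra_simps)
    moreover have "?b * (a + 1) - a = t * (a + 1) + a * a + a + 1"
      by (simp add: algebra_simps)
    ultimately show ?thesis using assms by simp
  qed
  have "continuous_on {t / 2..?b} f" unfolding f_def by (intro continuous_intros)
  then have "\<exists>x\<ge>t / 2. x \<le> ?b \<and> f x = 0"
    using lo hi assms by (intro IVT') auto
  then obtain x where x: "x > t / 2" "f x = 0"
    using lo by (metis less_eq_real_def less_irrefl)
  have uniq: "y = z" if "f y = 0" "f z = 0" "y > t / 2" "z > t / 2" for y z
  proof (rule ccontr)
    assume "y \<noteq> z"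
    let ?s = "t / 2"
    have "f ?s * (y - z) + f y * (z - ?s) + f z * (?s - y)
        = (?s - y) * (?s - z) * (y - z) * (3 * (?s + y + z) - 3 * t)"
      by (simp add: f_def power2_eq_square power3_eq_cube field_simps)
    then have "f ?s * (y - z) = ((?s - y) * (?s - z) * (3 * (?s + y + z) - 3 * t)) * (y - z)"
      using that by (simp only: mult_zero_left add_0_right mult_ac)
    then have "f ?s = (?s - y) * (?s - z) * (3 * (?s + y + z) - 3 * t)"
      using \<open>y \<noteq> z\<close> by simp
    moreover have "(?s - y) * (?s - z) > 0" using that by (intro mult_neg_neg) auto
    moreover have "3 * (?s + y + z) - 3 * t > 0" using that assms by (simp add: field_simps)
    ultimately show False using lo by (metis mult_pos_pos order_less_asym)
  qed
  have "\<exists>!x. f x = 0 \<and> x > t / 2" using x uniq by blast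
  then show ?thesis unfolding f_def .
qed

(* infsum is 0 on families that are not summable; this one is summable. *)
lemma summable_c1:
  "(\<lambda>p::nat. ln (real p) / (real p * (real p - 1))) summable_on {p. prime p \<and> p \<ge> 5}"
proof -
  have "summable (\<lambda>n::nat. 4 * real n powr (-3/2))"
    by (intro summable_mult) (simp add: summable_real_powr_iff)
  then have *: "(\<lambda>n::nat. 4 * real n powr (-3/2)) summable_on UNIV"
    by (intro norm_summable_imp_summable_on) simp
  have bound: "ln (real p) / (real p * (real p - 1)) \<le> 4 * real p powr (-3/2)" if "p \<ge> 5" for p :: nat
  proof -
    have p: "real p \<ge> 5" using that by simp
    have "ln (real p) = 2 * ln (sqrt (real p))" using p by (simp add: ln_sqrt)
    also have "\<dots> \<le> 2 * sqrt (real p)" using p ln_bound[of "sqrt (real p)"] by simp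
    finally have "ln (real p) / (real p * (real p - 1)) \<le> 2 * sqrt (real p) / (real p * (real p / 2))"
      using p by (intro frac_le mult_left_mono) auto
    also have "\<dots> = 4 * (real p powr (1/2) / real p powr 2)"
      using p by (simp add: powr_half_sqrt power2_eq_square)
    also have "\<dots> = 4 * real p powr (-3/2)" by (subst powr_diff [symmetric]) simp
    finally show ?thesis .
  qed
  show ?thesis
    by (rule summable_on_comparison_test[OF summable_on_subset_banach[OF * subset_UNIV]])
       (use bound in auto)
qed

definition c1 :: real where
  "c1 = 1 / (sqrt 3 * exp 1) *
     exp (- (\<Sum>\<^sub>\<infinity>p\<in>{p::nat. prime p \<and> p \<ge> 5}. ln (real p) / (real p * (real p - 1))))"

definition tau3 :: "real \<Rightarrow> real \<Rightarrow> real" where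
  "tau3 a t = 4 * (3 * t\<^sup>2 + a) / sqrt pi"

definition tau4 :: "real \<Rightarrow> real \<Rightarrow> real" where
  "tau4 a t = 105 * sqrt 3 * (exp 1)\<^sup>2 * a ^ 4 /
     (2 * sqrt pi * t * (t\<^sup>2 + 2 * a) * (3 * t\<^sup>2 + a))"

definition c6 :: "real \<Rightarrow> real \<Rightarrow> real" where
  "c6 a t = 144 * (t\<^sup>2 + a) ^ 3 / (c1\<^sup>2 * (exp 1)\<^sup>2)"

definition c7 :: "real \<Rightarrow> real \<Rightarrow> real" where
  "c7 a t = c1\<^sup>2 * (exp 1)\<^sup>2 * t ^ 4 * (t\<^sup>2 + 2 * a)\<^sup>2 / (9 * a ^ 6 * (t\<^sup>2 + a))"

end

theory Submission
  imports Defs "HOL-Number_Theory.Cong"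
begin

text \<open>
  Put \<open>s = (t\<^sup>2 + a) / a\<close>, \<open>\<delta>\<^sup>2 = s\<^sup>3 - 1\<close> and \<open>tan \<theta> = 1 / \<delta>\<close>. The substitution \<open>x = t s / (s - 1 + m)\<close>
  turns the cubic equation into \<open>s\<^sup>3 (1 - 3 m) = (1 - m)\<^sup>3\<close>, which is solved by
  \<open>m = tan (\<theta> / 3) / tan \<theta>\<close>. Hence rational approximations to \<open>x\<close> come from the diagonal Pade
  approximants of \<open>((\<delta> + \<i>) / (\<delta> - \<i>))\<close> to the power \<open>1/3\<close>: the sums
  \<open>\<Sum>k. binom(n + 1/3, k) binom(n - 1/3, n - k) (\<delta> + \<i>)^k (\<delta> - \<i>)^(n - k)\<close> have, for \<open>n = 2 j + 1\<close>, a real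
  part divided by \<open>\<delta>\<close> and an imaginary part that become integers after multiplication by
  \<open>3 (27 a\<^sup>3)^j\<close>. Their three-term recurrence bounds their growth by \<open>432 (t\<^sup>2 + a)\<^sup>3\<close> per step of \<open>j\<close>, shows
  that consecutive approximations differ, and identifies the remainders with hypergeometric series,
  which decay at least as fast as \<open>c\<^sub>7\<close> to the power \<open>- j\<close>. Of the prime sum in \<open>c\<^sub>1\<close> only its
  nonnegativity matters, since it gives \<open>432 (t\<^sup>2 + a)\<^sup>3 \<le> c\<^sub>6\<close>. Two consecutive approximations with
  \<open>j\<close> near \<open>log (2 \<tau>\<^sub>4 q) / log c\<^sub>7\<close> then yield the bound.
\<close>

section \<open>Denominators of binomial coefficients\<close>

lemma three_prime_nat: "prime (3::nat)"
proof (rule prime_nat_naiveI)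
  fix n :: nat
  assume n: "n dvd 3"
  then have "n \<le> 3" by (rule dvd_imp_le) simp
  then consider "n = 0" | "n = 1" | "n = 2" | "n = 3" by linarith
  then show "n = 1 \<or> n = 3" using n by cases simp_all
qed simp

lemma fact_Suc_nat: "fact (Suc n) = fact n * (n + 1)"
  by (subst fact_Suc) simp

text \<open>Legendre's formula by strong induction: grouping the factors of
  \<open>fact (3 * m)\<close> in threes extracts \<open>3 ^ m * fact m\<close> and leaves a factor
  prime to 3. So the exponent at \<open>3 * m + r\<close> is \<open>m\<close> plus the exponent at
  \<open>m\<close>, and \<open>2 * (m + e) \<le> 3 * m\<close>.\<close>

lemma fact_eq_power3_mult:
  "\<exists>e u::nat. fact k = 3 ^ e * u \<and> \<not> 3 dvd u \<and> 2 * e \<le> k"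
proof (induction k rule: less_induct)
  case (less k)
  have *: "\<exists>u::nat. fact (3 * m) = 3 ^ m * fact m * u \<and> \<not> 3 dvd u" for m :: nat
  proof (induction m)
    case 0
    show ?case by (rule exI[of _ 1]) simp
  next
    case (Suc m)
    then obtain u :: nat where u: "fact (3 * m) = 3 ^ m * fact m * u" "\<not> 3 dvd u" by blast
    have "3 * Suc m = Suc (Suc (Suc (3 * m)))" by simp
    then have "(fact (3 * Suc m) :: nat) = (3 * m + 3) * ((3 * m + 2) * ((3 * m + 1) * fact (3 * m)))"
      by (simp only: fact_Suc of_nat_id) (simp add: algebra_simps)
    also have "\<dots> = 3 ^ Suc m * fact (Suc m) * ((3 * m + 2) * (3 * m + 1) * u)"
      unfolding u(1) by (simp add: algebra_simps)
    finally have "fact (3 * Suc m) = 3 ^ Suc m * fact (Suc m) * ((3 * m + 2) * (3 * m + 1) * u)" .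
    moreover have "\<not> (3::nat) dvd (3 * m + 2) * (3 * m + 1) * u"
    proof -
      have "\<not> (3::nat) dvd 3 * m + 2" "\<not> (3::nat) dvd 3 * m + 1" by presburger+
      then show ?thesis using u(2) by (simp only: prime_dvd_mult_iff[OF three_prime_nat]) blast
    qed
    ultimately show ?case by blast
  qed
  show ?case
  proof (cases "k < 3")
    case True
    then consider "k = 0" | "k = 1" | "k = 2" by linarith
    then have "\<not> 3 dvd (fact k :: nat)" by cases (simp_all add: fact_2)
    then show ?thesis by (intro exI[of _ "0::nat"] exI[of _ "fact k :: nat"]) simp
  next
    case False
    define m r where "m = k div 3" and "r = k mod 3"
    have k: "k = 3 * m + r" "r < 3" by (auto simp: m_def r_def)
    have "m < k" using False k by linarith
    from less[OF this] obtain e u :: nat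
      where e: "fact m = 3 ^ e * u" "\<not> 3 dvd u" "2 * e \<le> m" by blast
    from *[of m] obtain u' :: nat where u': "fact (3 * m) = 3 ^ m * fact m * u'" "\<not> 3 dvd u'" by blast
    \<comment> \<open>The at most two remaining factors \<open>3 * m + 1\<close> and
      \<open>3 * m + 2\<close> are prime to 3.\<close>
    have "\<exists>c::nat. fact k = fact (3 * m) * c \<and> \<not> 3 dvd c"
    proof -
      from k(2) consider "r = 0" | "r = 1" | "r = 2" by linarith
      then show ?thesis
      proof cases
        case 1
        then have "k = 3 * m" using k by simp
        then show ?thesis by (intro exI[of _ 1]) simp
      next
        case 2
        have "\<not> 3 dvd 3 * m + 1" by presburger
        moreover have "k = Suc (3 * m)" using 2 k by simp
        moreover have "fact (Suc (3 * m)) = fact (3 * m) * (3 * m + 1)"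
          by (rule fact_Suc_nat)
        ultimately show ?thesis by blast
      next
        case 3
        have "\<not> 3 dvd 3 * m + 1" "\<not> 3 dvd 3 * m + 2" by presburger+
        then have "\<not> 3 dvd (3 * m + 2) * (3 * m + 1)"
          by (simp only: prime_dvd_mult_iff[OF three_prime_nat]) blast
        moreover have "k = Suc (Suc (3 * m))" using 3 k by simp
        moreover have "fact (Suc (Suc (3 * m))) = fact (3 * m) * ((3 * m + 2) * (3 * m + 1))"
          by (simp only: fact_Suc_nat) (simp add: algebra_simps)
        ultimately show ?thesis by blast
      qed
    qed
    then obtain c :: nat where c: "fact k = fact (3 * m) * c" "\<not> 3 dvd c" by blast
    have "fact k = 3 ^ (m + e) * (u * u' * c)"
      unfolding c(1) u'(1) e(1) power_add by (simp only: ac_simps)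
    moreover have "\<not> 3 dvd u * u' * c" using e(2) u'(2) c(2)
      by (simp only: prime_dvd_mult_iff[OF three_prime_nat]) blast
    moreover have "2 * (m + e) \<le> k" using e(3) k by presburger
    ultimately show ?thesis by blast
  qed
qed

text \<open>After multiplication by \<open>3 ^ k\<close> the binomial coefficient is a product of
  integers with common difference 3, divided by \<open>fact k\<close>. The part \<open>u\<close> of
  \<open>fact k\<close> prime to 3 always divides this product, so only the power of 3 in
  \<open>fact k\<close>, at most \<open>3 ^ (k div 2)\<close>, remains to be cleared.\<close>

lemma third_gbinomial_integral:
  fixes r :: int
  shows "3 ^ (k + k div 2) * ((of_int r / 3 :: real) gchoose k) \<in> \<int>"
proof -
  obtain e u :: nat where e: "fact k = 3 ^ e * u" "\<not> 3 dvd u" "2 * e \<le> k"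
    using fact_eq_power3_mult by blast
  have "coprime (int 3) (int u)"
    using e(2) by (simp only: coprime_int_iff) (simp add: prime_imp_coprime)
  then obtain b :: int where b: "[3 * b = 1] (mod int u)"
    using cong_solve_coprime_int[of 3 "int u"] by auto
  define P where "P = (\<Prod>i=0..<k. r - 3 * int i)"
  \<comment> \<open>Multiplying each factor by the inverse \<open>b\<close> of 3 modulo
    \<open>u\<close> yields a product of consecutive integers, which \<open>fact k\<close> and hence
    \<open>u\<close> divides.\<close>
  have "[(\<Prod>i=0..<k. b * (r - 3 * int i)) = (\<Prod>i=0..<k. b * r - int i)] (mod int u)"
  proof (rule cong_prod)
    fix i
    have "[b * r - (3 * b) * int i = b * r - 1 * int i] (mod int u)"
      by (intro cong_diff cong_mult b cong_refl)
    moreover have "b * r - (3 * b) * int i = b * (r - 3 * int i)" by (simp add: algebra_simps)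
    ultimately show "[b * (r - 3 * int i) = b * r - int i] (mod int u)" by (simp only: mult_1)
  qed
  moreover have "b ^ k * P = (\<Prod>i=0..<k. b * (r - 3 * int i))"
    by (simp add: P_def prod.distrib)
  ultimately have "[b ^ k * P = (\<Prod>i=0..<k. b * r - int i)] (mod int u)" by (simp only:)
  moreover have "int u dvd (\<Prod>i=0..<k. b * r - int i)"
  proof -
    have "(fact k :: int) dvd (\<Prod>i=0..<k. b * r - int i)"
      unfolding gbinomial_int_mult_fact[symmetric] by (rule dvd_triv_left)
    moreover have "int u dvd fact k" using arg_cong[OF e(1), of int]
      by (metis dvd_triv_right of_nat_fact of_nat_mult)
    ultimately show ?thesis by (metis dvd_trans)
  qed
  ultimately have "int u dvd b ^ k * P" by (simp add: cong_dvd_iff)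
  moreover have "coprime (int u) (b ^ k)"
  proof -
    have "coprime (3 * b) (int u)" using cong_imp_coprime[OF cong_sym[OF b]] by simp
    then have "coprime b (int u)" by simp
    then show ?thesis by (simp add: coprime_commute)
  qed
  ultimately have "int u dvd P" by (simp add: coprime_dvd_mult_right_iff)
  then obtain c where c: "P = int u * c" by blast
  have fk: "(fact k :: real) = 3 ^ e * real u"
    using arg_cong[OF e(1), of real] by simp
  have u0: "u > 0" using e(2) by (cases u) auto
  have "3 ^ k * ((of_int r / 3 :: real) gchoose k) = of_int P / fact k"
  proof -
    have "3 ^ k * (\<Prod>i=0..<k. (of_int r / 3 :: real) - of_nat i) = (\<Prod>i=0..<k. 3 * (of_int r / 3 - of_nat i))"
      unfolding prod.distrib by simp
    also have "\<dots> = of_int P" by (simp add: P_def right_diff_distrib)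
    finally show ?thesis by (simp add: gbinomial_prod_rev)
  qed
  then have "3 ^ (k + k div 2) * ((of_int r / 3 :: real) gchoose k) = 3 ^ (k div 2) * (of_int P / fact k)"
    by (simp only: power_add mult.assoc mult.left_commute[of "3 ^ k"])
  also have "\<dots> = 3 ^ (k div 2 - e) * of_int c"
  proof -
    have "k div 2 - e + e = k div 2" using e(3) by simp
    then have "(3::real) ^ (k div 2) = 3 ^ (k div 2 - e) * 3 ^ e"
      by (metis power_add)
    then show ?thesis using u0 unfolding c fk by (simp add: field_simps)
  qed
  finally show ?thesis by simp
qed

section \<open>Jacobi forms and their recurrence\<close>

definition jacobi_coeff :: "real \<Rightarrow> nat \<Rightarrow> nat \<Rightarrow> real" where
  "jacobi_coeff \<nu> n k = ((real n + \<nu>) gchoose k) * ((real n - \<nu>) gchoose (n - k))"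

text \<open>The form below is \<open>(X - Y)\<^sup>n\<close> times the Jacobi polynomial with parameters \<open>\<nu>, - \<nu>\<close>
  at \<open>(X + Y) / (X - Y)\<close>; its three-term recurrence is inherited from there.\<close>

definition jacobi_form :: "real \<Rightarrow> nat \<Rightarrow> complex \<Rightarrow> complex \<Rightarrow> complex" where
  "jacobi_form \<nu> n X Y = (\<Sum>k\<le>n. of_real (jacobi_coeff \<nu> n k) * X ^ k * Y ^ (n - k))"

text \<open>The reciprocal Gamma function vanishes at the nonpositive integers, so the coefficient identity
  needs no boundary cases at \<open>k = 0\<close>, \<open>k = 1\<close> and \<open>k > n\<close>.\<close>

definition rGamma_prod :: "real \<Rightarrow> real \<Rightarrow> real \<Rightarrow> real" where
  "rGamma_prod \<nu> n k = rGamma (k + 1) * rGamma (n - k + 1) * rGamma (n + \<nu> - k + 1) * rGamma (k - \<nu> + 1)"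

definition Gamma_prod :: "real \<Rightarrow> nat \<Rightarrow> real" where
  "Gamma_prod \<nu> n = Gamma (real n + \<nu> + 1) * Gamma (real n - \<nu> + 1)"

text \<open>By \<open>rGamma z = z * rGamma (z + 1)\<close> all six products are polynomial
  multiples of the single product \<open>A * B * C * D\<close>. What remains is a polynomial
  identity, so \<open>n\<close> and \<open>k\<close> may be arbitrary reals.\<close>

lemma rGamma_prod_recurrence:
  "n * (n + 1) * ((n + 1)\<^sup>2 - \<nu>\<^sup>2) * rGamma_prod \<nu> (n + 1) k =
   n * (2 * n + 1) * (rGamma_prod \<nu> n (k - 1) + rGamma_prod \<nu> n k)
   - (rGamma_prod \<nu> (n - 1) (k - 2) - 2 * rGamma_prod \<nu> (n - 1) (k - 1) + rGamma_prod \<nu> (n - 1) k)"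
proof -
  let ?r = "rGamma :: real \<Rightarrow> real"
  define A B C D where "A = ?r (k + 1)" and "B = ?r (n - k + 2)"
    and "C = ?r (n + \<nu> - k + 2)" and "D = ?r (k - \<nu> + 1)"
  have A: "?r k = k * A" "?r (k - 1) = (k - 1) * (k * A)"
    using rGamma_plus1[of k] rGamma_plus1[of "k - 1"] by (simp_all add: A_def)
  have D: "?r (k - \<nu>) = (k - \<nu>) * D" "?r (k - \<nu> - 1) = (k - \<nu> - 1) * ((k - \<nu>) * D)"
    using rGamma_plus1[of "k - \<nu>"] rGamma_plus1[of "k - \<nu> - 1"] by (simp_all add: D_def)
  have B: "?r (n - k + 1) = (n - k + 1) * B" "?r (n - k) = (n - k) * ((n - k + 1) * B)"
    using rGamma_plus1[of "n - k + 1"] rGamma_plus1[of "n - k"] by (simp_all add: B_def add.commute)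
  have C: "?r (n + \<nu> - k + 1) = (n + \<nu> - k + 1) * C" "?r (n + \<nu> - k) = (n + \<nu> - k) * ((n + \<nu> - k + 1) * C)"
    using rGamma_plus1[of "n + \<nu> - k + 1"] rGamma_plus1[of "n + \<nu> - k"] by (simp_all add: C_def algebra_simps)
  have idx: "n + 1 - k + 1 = n - k + 2" "n + 1 + \<nu> - k + 1 = n + \<nu> - k + 2" "k - 1 + 1 = k"
    "n - (k - 1) + 1 = n - k + 2" "n + \<nu> - (k - 1) + 1 = n + \<nu> - k + 2" "k - 1 - \<nu> + 1 = k - \<nu>"
    "n - 1 - k + 1 = n - k" "n - 1 + \<nu> - k + 1 = n + \<nu> - k"
    "n - 1 - (k - 1) + 1 = n - k + 1" "n - 1 + \<nu> - (k - 1) + 1 = n + \<nu> - k + 1"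
    "k - 2 + 1 = k - 1" "n - 1 - (k - 2) + 1 = n - k + 2"
    "n - 1 + \<nu> - (k - 2) + 1 = n + \<nu> - k + 2" "k - 2 - \<nu> + 1 = k - \<nu> - 1"
    by simp_all
  note rules = rGamma_prod_def idx A B C D A_def[symmetric] B_def[symmetric] C_def[symmetric] D_def[symmetric]
  have 1: "rGamma_prod \<nu> (n + 1) k = A * B * C * D" by (simp only: rules)
  have 2: "rGamma_prod \<nu> n k = A * ((n - k + 1) * B) * ((n + \<nu> - k + 1) * C) * D"
    by (simp only: rules)
  have 3: "rGamma_prod \<nu> n (k - 1) = (k * A) * B * C * ((k - \<nu>) * D)" by (simp only: rules)
  have 4: "rGamma_prod \<nu> (n - 1) k =
      A * ((n - k) * ((n - k + 1) * B)) * ((n + \<nu> - k) * ((n + \<nu> - k + 1) * C)) * D"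
    by (simp only: rules)
  have 5: "rGamma_prod \<nu> (n - 1) (k - 1) =
      (k * A) * ((n - k + 1) * B) * ((n + \<nu> - k + 1) * C) * ((k - \<nu>) * D)"
    by (simp only: rules)
  have 6: "rGamma_prod \<nu> (n - 1) (k - 2) = ((k - 1) * (k * A)) * B * C * ((k - \<nu> - 1) * ((k - \<nu>) * D))"
    by (simp only: rules)
  show ?thesis unfolding 1 2 3 4 5 6 by algebra
qed

context
  fixes \<nu> :: real
  assumes \<nu>: "\<bar>\<nu>\<bar> < 1"
begin

lemma jacobi_coeff_rGamma:
  assumes "k \<le> n"
  shows "jacobi_coeff \<nu> n k = Gamma_prod \<nu> n * rGamma_prod \<nu> (real n) (real k)"
proof -
  \<comment> \<open>\<open>\<bar>\<nu>\<bar> < 1\<close> keeps both arguments away from the poles of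
    Gamma.\<close>
  have "real n + \<nu> + 1 > 0" "real n - \<nu> + 1 > 0" using \<nu> by linarith+
  then have *: "real n + \<nu> + 1 \<notin> \<int>\<^sub>\<le>\<^sub>0" "real n - \<nu> + 1 \<notin> \<int>\<^sub>\<le>\<^sub>0" by (auto elim!: nonpos_Ints_cases')
  have f: "1 / fact j = rGamma (real j + 1)" for j
    by (simp add: rGamma_inverse_Gamma Gamma_fact inverse_eq_divide add.commute)
  have "jacobi_coeff \<nu> n k =
     Gamma (real n + \<nu> + 1) * (1 / fact k) * rGamma (real n + \<nu> - real k + 1) *
     (Gamma (real n - \<nu> + 1) * (1 / fact (n - k)) * rGamma (real n - \<nu> - real (n - k) + 1))"
    unfolding jacobi_coeff_def gbinomial_Gamma[OF *(1)] gbinomial_Gamma[OF *(2)]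
    by (simp add: rGamma_inverse_Gamma field_simps)
  then show ?thesis
    unfolding f Gamma_prod_def rGamma_prod_def using assms by (simp add: of_nat_diff algebra_simps)
qed

lemma rGamma_prod_eq_0:
  assumes "k > n"
  shows "rGamma_prod \<nu> (real n) (real k) = 0"
proof -
  have "real n - real k + 1 = of_int (int n - int k + 1)" by simp
  also have "\<dots> \<in> \<int>\<^sub>\<le>\<^sub>0" using assms by (intro nonpos_Ints_of_int) simp
  finally have "real n - real k + 1 \<in> \<int>\<^sub>\<le>\<^sub>0" .
  then have "rGamma (real n - real k + 1) = 0" by (simp add: rGamma_eq_zero_iff)
  then show ?thesis by (simp add: rGamma_prod_def)
qed

lemma Gamma_prod_Suc: "Gamma_prod \<nu> (Suc n) = ((real n + 1)\<^sup>2 - \<nu>\<^sup>2) * Gamma_prod \<nu> n"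
proof -
  have "real n + \<nu> + 1 > 0" "real n - \<nu> + 1 > 0" using \<nu> by linarith+
  then have "real n + \<nu> + 1 \<notin> \<int>\<^sub>\<le>\<^sub>0" "real n - \<nu> + 1 \<notin> \<int>\<^sub>\<le>\<^sub>0" by (auto elim!: nonpos_Ints_cases')
  from Gamma_plus1[OF this(1)] Gamma_plus1[OF this(2)]
  have *: "Gamma (real (Suc n) + \<nu> + 1) = (real n + \<nu> + 1) * Gamma (real n + \<nu> + 1)"
    and **: "Gamma (real (Suc n) - \<nu> + 1) = (real n - \<nu> + 1) * Gamma (real n - \<nu> + 1)"
    by (simp_all add: algebra_simps)
  show ?thesis unfolding Gamma_prod_def * ** by algebra
qed

text \<open>The classical recurrence of the Jacobi polynomials; because the two parameters are
  opposite, its middle factor is a multiple of \<open>X + Y\<close>. It is checked coefficientwise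
  for the dehomogenised polynomials \<open>P n\<close> in the variable \<open>X / Y\<close> and then
  multiplied by \<open>Y ^ (n + 2)\<close>.\<close>

lemma jacobi_form_recurrence:
  assumes Y: "Y \<noteq> 0"
  shows "of_nat (Suc n) * of_nat (Suc (Suc n)) * jacobi_form \<nu> (Suc (Suc n)) X Y =
    of_nat (Suc n) * of_nat (2 * n + 3) * (X + Y) * jacobi_form \<nu> (Suc n) X Y
    - of_real ((real n + 1)\<^sup>2 - \<nu>\<^sup>2) * (X - Y)\<^sup>2 * jacobi_form \<nu> n X Y"
proof -
  define h where "h = (\<lambda>n k::nat. Gamma_prod \<nu> n * rGamma_prod \<nu> (real n) (real k))"
  define P :: "nat \<Rightarrow> complex poly" where "P = (\<lambda>n. \<Sum>k\<le>n. monom (of_real (jacobi_coeff \<nu> n k)) k)"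
  have cP: "coeff (P n) k = of_real (Gamma_prod \<nu> n * rGamma_prod \<nu> (real n) (real k))" for n k
    by (cases "k \<le> n") (auto simp: P_def coeff_sum jacobi_coeff_rGamma rGamma_prod_eq_0)
  \<comment> \<open>Vanishing at negative lower indices lets the shifts by \<open>monom 1 1\<close>
    and \<open>monom 1 2\<close> follow one formula also at \<open>k = 0\<close> and
    \<open>k = 1\<close>.\<close>
  have cm: "rGamma_prod \<nu> m (- real (Suc j)) = 0" for m j
    unfolding rGamma_prod_def by (simp add: rGamma_eq_zero_iff)
  have c1: "coeff (monom 1 1 * P n) k = of_real (Gamma_prod \<nu> n * rGamma_prod \<nu> (real n) (real k - 1))" for n k
    using cm[of "real n" 0] by (cases k) (auto simp: coeff_monom_mult cP)
  have c2: "coeff (monom 1 2 * P n) k = of_real (Gamma_prod \<nu> n * rGamma_prod \<nu> (real n) (real k - 2))" for n k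
  proof -
    consider "k = 0" | "k = 1" | j where "k = Suc (Suc j)" by (metis One_nat_def not0_implies_Suc)
    then show ?thesis
      using cm[of "real n" 0] cm[of "real n" 1] by cases (auto simp: coeff_monom_mult cP numeral_2_eq_2)
  qed
  let ?c = "\<lambda>x. [:complex_of_real x:]"
  have "?c (real (Suc n) * real (Suc (Suc n))) * P (Suc (Suc n)) =
     ?c (real (Suc n) * real (2 * n + 3)) * (monom 1 1 * P (Suc n) + P (Suc n))
     - ?c ((real n + 1)\<^sup>2 - \<nu>\<^sup>2) * (monom 1 2 * P n - ?c 2 * (monom 1 1 * P n) + P n)"
  proof (rule poly_eqI)
    fix k
    let ?m = "real n + 1" and ?G = "Gamma_prod \<nu> n" and ?k = "real k"
    have "real (Suc n) * real (Suc (Suc n)) * (Gamma_prod \<nu> (Suc (Suc n)) * rGamma_prod \<nu> (?m + 1) ?k)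
      = ?m * (?m + 1) * ((?m + 1)\<^sup>2 - \<nu>\<^sup>2) * rGamma_prod \<nu> (?m + 1) ?k * ((?m\<^sup>2 - \<nu>\<^sup>2) * ?G)"
      unfolding Gamma_prod_Suc by (simp add: algebra_simps)
    also have "\<dots> = real (Suc n) * real (2 * n + 3) * (Gamma_prod \<nu> (Suc n) * rGamma_prod \<nu> ?m (?k - 1)
         + Gamma_prod \<nu> (Suc n) * rGamma_prod \<nu> ?m ?k)
       - ((real n + 1)\<^sup>2 - \<nu>\<^sup>2) * (?G * rGamma_prod \<nu> (?m - 1) (?k - 2)
         - 2 * (?G * rGamma_prod \<nu> (?m - 1) (?k - 1)) + ?G * rGamma_prod \<nu> (?m - 1) ?k)"
      unfolding rGamma_prod_recurrence Gamma_prod_Suc by (simp add: algebra_simps)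
    finally have *: "real (Suc n) * real (Suc (Suc n)) * (Gamma_prod \<nu> (Suc (Suc n)) * rGamma_prod \<nu> (real (Suc (Suc n))) ?k)
      = real (Suc n) * real (2 * n + 3) * (Gamma_prod \<nu> (Suc n) * rGamma_prod \<nu> (real (Suc n)) (?k - 1)
         + Gamma_prod \<nu> (Suc n) * rGamma_prod \<nu> (real (Suc n)) ?k)
       - ((real n + 1)\<^sup>2 - \<nu>\<^sup>2) * (?G * rGamma_prod \<nu> (real n) (?k - 2)
         - 2 * (?G * rGamma_prod \<nu> (real n) (?k - 1)) + ?G * rGamma_prod \<nu> (real n) ?k)"
      by (simp add: algebra_simps)
    show "coeff (?c (real (Suc n) * real (Suc (Suc n))) * P (Suc (Suc n))) k =
     coeff (?c (real (Suc n) * real (2 * n + 3)) * (monom 1 1 * P (Suc n) + P (Suc n))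
     - ?c ((real n + 1)\<^sup>2 - \<nu>\<^sup>2) * (monom 1 2 * P n - ?c 2 * (monom 1 1 * P n) + P n)) k"
      using arg_cong[OF *, of complex_of_real]
      by (simp only: mult_pCons_left mult_zero_left smult_0_left pCons_0_0 add_0_right coeff_smult
          coeff_add coeff_diff cP c1 c2 of_real_mult of_real_add of_real_diff of_real_numeral)
  qed
  from arg_cong[OF this, of "\<lambda>p. Y ^ Suc (Suc n) * poly p (X / Y)"]
  have *: "Y ^ Suc (Suc n) * (of_real (real (Suc n) * real (Suc (Suc n))) * poly (P (Suc (Suc n))) (X / Y)) =
     Y ^ Suc (Suc n) * (of_real (real (Suc n) * real (2 * n + 3)) * ((X / Y) * poly (P (Suc n)) (X / Y) + poly (P (Suc n)) (X / Y))
     - of_real ((real n + 1)\<^sup>2 - \<nu>\<^sup>2) * ((X / Y)\<^sup>2 * poly (P n) (X / Y) - 2 * ((X / Y) * poly (P n) (X / Y)) + poly (P n) (X / Y)))"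
    by (simp only: poly_mult poly_diff poly_add poly_pCons poly_0 mult_zero_right add_0_right poly_monom mult_1 power_one_right of_real_numeral)
  have J: "jacobi_form \<nu> n X Y = Y ^ n * poly (P n) (X / Y)" for n
    unfolding jacobi_form_def P_def poly_sum poly_monom sum_distrib_left
    using Y by (intro sum.cong) (auto simp: power_divide power_diff)
  have "of_nat (Suc n) * of_nat (Suc (Suc n)) * jacobi_form \<nu> (Suc (Suc n)) X Y =
     Y ^ Suc (Suc n) * (of_real (real (Suc n) * real (Suc (Suc n))) * poly (P (Suc (Suc n))) (X / Y))"
    unfolding J by (simp add: algebra_simps)
  also note *
  also have "Y ^ Suc (Suc n) * (of_real (real (Suc n) * real (2 * n + 3)) * ((X / Y) * poly (P (Suc n)) (X / Y) + poly (P (Suc n)) (X / Y))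
     - of_real ((real n + 1)\<^sup>2 - \<nu>\<^sup>2) * ((X / Y)\<^sup>2 * poly (P n) (X / Y) - 2 * ((X / Y) * poly (P n) (X / Y)) + poly (P n) (X / Y)))
    = of_nat (Suc n) * of_nat (2 * n + 3) * (X + Y) * jacobi_form \<nu> (Suc n) X Y
    - of_real ((real n + 1)\<^sup>2 - \<nu>\<^sup>2) * (X - Y)\<^sup>2 * jacobi_form \<nu> n X Y"
    unfolding J using Y by (simp add: field_simps power2_eq_square)
  finally show ?thesis .
qed

end

section \<open>The hypergeometric remainders\<close>

definition tan_coeff :: "real \<Rightarrow> nat \<Rightarrow> nat \<Rightarrow> real" where
  "tan_coeff \<nu> n k = pochhammer (real n - \<nu>) (2 * k) / (4 ^ k * pochhammer (real n + 1 / 2) k * fact k)"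

text \<open>This is Gauss' \<open>F((n - \<nu>)/2, (n + 1 - \<nu>)/2; n + 1/2; - y)\<close>. The contiguous relation between three
  consecutive ones is Euler's continued fraction of \<open>tan (\<nu> \<theta>) / tan \<theta>\<close>.\<close>

definition tan_series :: "real \<Rightarrow> nat \<Rightarrow> real \<Rightarrow> real" where
  "tan_series \<nu> n y = (\<Sum>k. tan_coeff \<nu> n k * (- y) ^ k)"

lemma tan_coeff_0 [simp]: "tan_coeff \<nu> n 0 = 1"
  by (simp add: tan_coeff_def)

lemma tan_coeff_Suc:
  "tan_coeff \<nu> n (Suc k) = tan_coeff \<nu> n k *
     ((real n - \<nu> + 2 * real k) * (real n - \<nu> + 2 * real k + 1) / (4 * (real n + 1 / 2 + real k) * (real k + 1)))"
proof -
  have "pochhammer (real n - \<nu>) (2 * Suc k) =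
     pochhammer (real n - \<nu>) (2 * k) * ((real n - \<nu> + 2 * real k) * (real n - \<nu> + 2 * real k + 1))"
    by (simp add: pochhammer_Suc algebra_simps)
  then show ?thesis
    unfolding tan_coeff_def pochhammer_Suc fact_Suc power_Suc
    by (simp add: mult_ac add_ac)
qed

text \<open>The ratio of consecutive coefficients is at most \<open>(n + k + 1) / (k + 1)\<close> in
  absolute value, which is the ratio for the binomials. Hence the series is dominated by that of
  \<open>1 / (1 - y) ^ (n + 1)\<close>, which gives both convergence and size.\<close>

lemma abs_tan_coeff_le:
  assumes "\<bar>\<nu>\<bar> \<le> 1"
  shows "\<bar>tan_coeff \<nu> n k\<bar> \<le> real ((n + k) choose k)"
proof (induction k)
  case (Suc k)
  let ?q = "(real n - \<nu> + 2 * real k) * (real n - \<nu> + 2 * real k + 1) / (4 * (real n + 1 / 2 + real k) * (real k + 1))"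
  have "\<bar>(real n - \<nu> + 2 * real k) * (real n - \<nu> + 2 * real k + 1)\<bar>
      \<le> (2 * real n + 2 * real k + 1) * (2 * real n + 2 * real k + 2)"
    unfolding abs_mult
  proof (intro mult_mono)
    show "\<bar>real n - \<nu> + 2 * real k\<bar> \<le> 2 * real n + 2 * real k + 1" using assms by (auto simp: abs_le_iff)
    show "\<bar>real n - \<nu> + 2 * real k + 1\<bar> \<le> 2 * real n + 2 * real k + 2" using assms by (auto simp: abs_le_iff)
  qed auto
  then have "\<bar>?q\<bar> \<le> (2 * real n + 2 * real k + 1) * (2 * real n + 2 * real k + 2) / (4 * (real n + 1 / 2 + real k) * (real k + 1))"
    unfolding abs_divide by (simp add: abs_mult divide_right_mono)
  also have "\<dots> = (real n + real k + 1) / (real k + 1)"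
    by (simp add: divide_simps) (simp add: algebra_simps)
  finally have "\<bar>tan_coeff \<nu> n (Suc k)\<bar> \<le> real ((n + k) choose k) * ((real n + real k + 1) / (real k + 1))"
    unfolding tan_coeff_Suc abs_mult by (intro mult_mono Suc) auto
  also have "\<dots> = real ((n + Suc k) choose Suc k)"
  proof -
    have "Suc k * (Suc (n + k) choose Suc k) = Suc (n + k) * ((n + k) choose k)"
      using Suc_times_binomial_eq[of "n + k" k] by (simp only: mult.commute)
    from arg_cong[OF this, of real] show ?thesis by (simp add: field_simps)
  qed
  finally show ?case .
qed simp

lemma neg_binomial_sums:
  assumes "0 \<le> y" "y < (1::real)"
  shows "(\<lambda>k. real ((n + k) choose k) * y ^ k) sums (1 / (1 - y) ^ (n + 1))"
proof -
  have "(- real (n + 1) gchoose k) * (- y) ^ k = real ((n + k) choose k) * y ^ k" for k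
  proof -
    have "(- real (n + 1) gchoose k) = (- 1) ^ k * (real (n + k) gchoose k)"
      unfolding gbinomial_minus by (simp add: algebra_simps)
    moreover have "(- 1) ^ k * (- y) ^ k = y ^ k" by (simp flip: power_mult_distrib)
    ultimately show ?thesis by (simp add: binomial_gbinomial)
  qed
  moreover have "(1 + - y) powr (- real (n + 1)) = 1 / (1 - y) ^ (n + 1)"
    using assms by (simp only: powr_minus powr_realpow) (simp add: powr_realpow divide_inverse del: of_nat_add)
  ultimately show ?thesis
    using gen_binomial_real[of "- y" "- real (n + 1)"] assms by simp
qed

context
  fixes \<nu> y :: real
  assumes \<nu>: "\<bar>\<nu>\<bar> \<le> 1" and y: "0 \<le> y" "y < 1"
begin

lemma tan_series_norm_le: "norm (tan_coeff \<nu> n k * (- y) ^ k) \<le> real ((n + k) choose k) * y ^ k"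
  using mult_right_mono[OF abs_tan_coeff_le[OF \<nu>, of n k], of "y ^ k"] y
  by (simp add: abs_mult power_abs)

lemma summable_tan_series: "summable (\<lambda>k. tan_coeff \<nu> n k * (- y) ^ k)"
  by (rule summable_comparison_test'[OF sums_summable[OF neg_binomial_sums[OF y]] tan_series_norm_le])

lemma tan_series_sums: "(\<lambda>k. tan_coeff \<nu> n k * (- y) ^ k) sums tan_series \<nu> n y"
  unfolding tan_series_def using summable_tan_series by (rule summable_sums)

lemma abs_tan_series_le: "\<bar>tan_series \<nu> n y\<bar> \<le> 1 / (1 - y) ^ (n + 1)"
  using norm_suminf_le[OF tan_series_norm_le sums_summable[OF neg_binomial_sums[OF y]]]
    sums_unique[OF neg_binomial_sums[OF y, of n]]
  by (simp add: tan_series_def)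

lemma abs_tan_series_minus_1_le: "\<bar>tan_series \<nu> n y - 1\<bar> \<le> 1 / (1 - y) ^ (n + 1) - 1"
proof -
  have "(\<lambda>k. tan_coeff \<nu> n (Suc k) * (- y) ^ Suc k) sums (tan_series \<nu> n y - 1)"
    using tan_series_sums[of n] by (subst sums_Suc_iff) simp
  moreover have "(\<lambda>k. real ((n + Suc k) choose Suc k) * y ^ Suc k) sums (1 / (1 - y) ^ (n + 1) - 1)"
    using neg_binomial_sums[OF y, of n] by (subst sums_Suc_iff) simp
  ultimately show ?thesis
    using norm_suminf_le[of "\<lambda>k. tan_coeff \<nu> n (Suc k) * (- y) ^ Suc k"
        "\<lambda>k. real ((n + Suc k) choose Suc k) * y ^ Suc k", OF tan_series_norm_le]
    by (simp only: sums_iff real_norm_def)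
qed

text \<open>Coefficient comparison: the constant terms cancel, and each later difference between
  index \<open>n\<close> and index \<open>n + 1\<close> is the constant \<open>- \<kappa>\<close>
  times the preceding coefficient with index \<open>n + 2\<close>.\<close>

lemma tan_series_contiguous:
  "tan_series \<nu> n y = tan_series \<nu> (Suc n) y
     + y * ((real n + 1)\<^sup>2 - \<nu>\<^sup>2) / (4 * (real n + 1)\<^sup>2 - 1) * tan_series \<nu> (Suc (Suc n)) y"
proof -
  define \<kappa> where "\<kappa> = ((real n + 1)\<^sup>2 - \<nu>\<^sup>2) / (4 * (real n + 1)\<^sup>2 - 1)"
  have coeff: "tan_coeff \<nu> n (Suc k) - tan_coeff \<nu> (Suc n) (Suc k) = - \<kappa> * tan_coeff \<nu> (Suc (Suc n)) k" for k
  proof -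
    let ?m = "real n + 1" and ?k = "real k"
    \<comment> \<open>\<open>U\<close> and \<open>V\<close> are the Pochhammer symbols of the
      coefficient with index \<open>n + 2\<close>; the other two coefficients differ from it by a
      few linear factors.\<close>
    define U where "U = pochhammer (?m + 1 - \<nu>) (2 * k)"
    define V where "V = pochhammer (?m + 3 / 2) k"
    have V: "V > 0" unfolding V_def by (rule pochhammer_pos) simp
    have u0: "pochhammer (?m - 1 - \<nu>) (2 * Suc k) = (?m - 1 - \<nu>) * (?m - \<nu>) * U"
      by (simp add: U_def pochhammer_rec algebra_simps)
    have u1: "pochhammer (?m - \<nu>) (2 * Suc k) = (?m - \<nu>) * U * (?m + 1 - \<nu> + 2 * ?k)"
    proof -
      have "pochhammer (?m - \<nu>) (Suc (Suc (2 * k))) = (?m - \<nu>) * pochhammer (?m - \<nu> + 1) (Suc (2 * k))"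
        by (rule pochhammer_rec)
      also have "?m - \<nu> + 1 = ?m + 1 - \<nu>" by simp
      finally show ?thesis by (simp add: U_def pochhammer_Suc)
    qed
    have v1: "pochhammer (?m + 1 / 2) (Suc k) = (?m + 1 / 2) * V"
      by (simp add: V_def pochhammer_rec add.assoc)
    have v0: "pochhammer (?m - 1 / 2) (Suc k) = (?m - 1 / 2) * (?m + 1 / 2) * V / (?m + 1 / 2 + ?k)"
    proof -
      have "pochhammer (?m - 1 / 2) (Suc k) * (?m + 1 / 2 + ?k) = pochhammer (?m - 1 / 2) (Suc (Suc k))"
        by (simp add: pochhammer_Suc algebra_simps)
      also have "\<dots> = (?m - 1 / 2) * pochhammer (?m + 1 / 2) (Suc k)"
        by (subst pochhammer_rec) (simp add: algebra_simps)
      finally show ?thesis unfolding v1 by (simp add: field_simps)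
    qed
    have c0: "tan_coeff \<nu> n (Suc k) = (?m - 1 - \<nu>) * (?m - \<nu>) * U /
        (4 ^ Suc k * ((?m - 1 / 2) * (?m + 1 / 2) * V / (?m + 1 / 2 + ?k)) * fact (Suc k))"
    proof -
      have "real n - \<nu> = ?m - 1 - \<nu>" "real n + 1 / 2 = ?m - 1 / 2" by simp_all
      then show ?thesis unfolding tan_coeff_def u0[symmetric] v0[symmetric] by (simp only:)
    qed
    have c1: "tan_coeff \<nu> (Suc n) (Suc k) = (?m - \<nu>) * U * (?m + 1 - \<nu> + 2 * ?k) /
        (4 ^ Suc k * ((?m + 1 / 2) * V) * fact (Suc k))"
    proof -
      have "real (Suc n) = ?m" by simp
      then show ?thesis unfolding tan_coeff_def u1[symmetric] v1[symmetric] by (simp only:)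
    qed
    have c2: "tan_coeff \<nu> (Suc (Suc n)) k = U / (4 ^ k * V * fact k)"
      unfolding tan_coeff_def U_def V_def by (simp add: algebra_simps)
    have pos: "?m - 1 / 2 > 0" "?m + 1 / 2 > 0" "?m + 1 / 2 + ?k > 0" "?k + 1 > 0" by simp_all
    define W where "W = U / (4 ^ k * V * fact k)"
    have c0': "tan_coeff \<nu> n (Suc k) = W * ((?m - 1 - \<nu>) * (?m - \<nu>) * (?m + 1 / 2 + ?k) /
        (4 * ((?m - 1 / 2) * (?m + 1 / 2)) * (?k + 1)))"
    proof -
      have "a * b * u / (4 * e * (p * q * v / r) * (s * f)) = u / (e * v * f) * (a * b * r / (4 * (p * q) * s))"
        for a b u e p q v r s f :: real by (simp add: mult_ac)
      then show ?thesis unfolding c0 W_def power_Suc fact_Suc of_nat_Suc by (simp only: add.commute[of 1])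
    qed
    have c1': "tan_coeff \<nu> (Suc n) (Suc k) = W * ((?m - \<nu>) * (?m + 1 - \<nu> + 2 * ?k) / (4 * (?m + 1 / 2) * (?k + 1)))"
    proof -
      have "b * u * g / (4 * e * (q * v) * (s * f)) = u / (e * v * f) * (b * g / (4 * q * s))"
        for b u e q v g s f :: real by (simp add: mult_ac)
      then show ?thesis unfolding c1 W_def power_Suc fact_Suc of_nat_Suc by (simp only: add.commute[of 1])
    qed
    have \<kappa>: "\<kappa> = (?m - \<nu>) * (?m + \<nu>) / (4 * ((?m - 1 / 2) * (?m + 1 / 2)))"
      unfolding \<kappa>_def by (rule arg_cong2[of _ _ _ _ "(/)"]) (simp_all add: power2_eq_square algebra_simps)
    have "(?m - 1 - \<nu>) * (?m - \<nu>) * (?m + 1 / 2 + ?k) / (4 * ((?m - 1 / 2) * (?m + 1 / 2)) * (?k + 1))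
       - (?m - \<nu>) * (?m + 1 - \<nu> + 2 * ?k) / (4 * (?m + 1 / 2) * (?k + 1)) = - \<kappa>"
    proof -
      have *: "a * b * c / (4 * (p * q) * r) - b * e / (4 * q * r) = - (b * f / (4 * (p * q)))"
        if "p > 0" "q > 0" "r > 0" "b * (a * c - e * p) = b * (- f * r)" for a b c e f p q r :: real
        using that by (simp add: divide_simps) (simp add: algebra_simps)
      show ?thesis unfolding \<kappa> by (rule *) (use pos in \<open>simp_all add: field_simps\<close>)
    qed
    then show ?thesis unfolding c0' c1' c2 W_def[symmetric] right_diff_distrib[symmetric]
      by (simp only: mult.commute)
  qed
  have "(\<lambda>k. (tan_coeff \<nu> n k - tan_coeff \<nu> (Suc n) k) * (- y) ^ k) sums (tan_series \<nu> n y - tan_series \<nu> (Suc n) y)"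
    using sums_diff[OF tan_series_sums[of n] tan_series_sums[of "Suc n"]] by (simp only: left_diff_distrib)
  \<comment> \<open>Both coefficients equal 1 at \<open>k = 0\<close>, so the term dropped by the
    shift is zero.\<close>
  then have "(\<lambda>k. (tan_coeff \<nu> n (Suc k) - tan_coeff \<nu> (Suc n) (Suc k)) * (- y) ^ Suc k)
      sums (tan_series \<nu> n y - tan_series \<nu> (Suc n) y)"
    by (subst sums_Suc_iff) simp
  moreover have "(\<lambda>k. (y * \<kappa>) * (tan_coeff \<nu> (Suc (Suc n)) k * (- y) ^ k)) sums (y * \<kappa> * tan_series \<nu> (Suc (Suc n)) y)"
    by (intro sums_mult tan_series_sums)
  ultimately have "tan_series \<nu> n y - tan_series \<nu> (Suc n) y = y * \<kappa> * tan_series \<nu> (Suc (Suc n)) y"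
    unfolding coeff by (intro sums_unique2) (simp_all add: mult_ac)
  then show ?thesis by (simp add: \<kappa>_def)
qed

end

section \<open>The binomial series of a complex power, split by parity\<close>

lemma gbinomial_even: "(\<nu> gchoose (2 * k)) = tan_coeff \<nu> 0 k"
  unfolding gbinomial_pochhammer tan_coeff_def fact_double by (simp add: power_mult)

lemma gbinomial_odd: "(\<nu> gchoose Suc (2 * k)) = \<nu> * tan_coeff \<nu> 1 k"
proof -
  have "pochhammer (1 / 2 :: real) (Suc k) = 1 / 2 * pochhammer (3 / 2) k"
    by (simp add: pochhammer_rec)
  then have *: "pochhammer (3 / 2 :: real) k = (2 * real k + 1) * pochhammer (1 / 2) k"
    by (simp add: pochhammer_Suc field_simps)
  have "(fact (Suc (2 * k)) :: real) = 4 ^ k * pochhammer (3 / 2) k * fact k"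
    unfolding fact_Suc fact_double * power_mult by (simp add: algebra_simps)
  moreover have "pochhammer (- \<nu>) (Suc (2 * k)) = - \<nu> * pochhammer (1 - \<nu>) (2 * k)"
    by (simp add: pochhammer_rec)
  ultimately show ?thesis
    unfolding gbinomial_pochhammer tan_coeff_def by (simp add: power_mult)
qed

text \<open>In the binomial series the even powers of \<open>\<i> * \<tau>\<close> are real and sum
  to the series with index 0, the odd ones are imaginary and give the series with index 1.\<close>

lemma binomial_powr_tan_series:
  fixes \<nu> \<tau> :: real
  assumes "\<bar>\<nu>\<bar> \<le> 1" "\<bar>\<tau>\<bar> < 1"
  shows "(1 + \<i> * of_real \<tau>) powr of_real \<nu> = Complex (tan_series \<nu> 0 (\<tau>\<^sup>2)) (\<nu> * \<tau> * tan_series \<nu> 1 (\<tau>\<^sup>2))"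
proof -
  have y: "0 \<le> \<tau>\<^sup>2" "\<tau>\<^sup>2 < 1" using assms(2) by (simp_all add: abs_square_less_1)
  define f where "f = (\<lambda>k. (of_real \<nu> gchoose k) * (\<i> * complex_of_real \<tau>) ^ k)"
  have g: "(complex_of_real \<nu> gchoose k) = of_real (\<nu> gchoose k)" for k
    by (simp add: gbinomial_prod_rev)
  have p: "(\<i> * complex_of_real \<tau>) ^ (2 * k) = of_real ((- (\<tau>\<^sup>2)) ^ k)" for k
    by (simp add: power_mult power_mult_distrib)
  have e: "f (2 * k) = of_real (tan_coeff \<nu> 0 k * (- (\<tau>\<^sup>2)) ^ k)" for k
    unfolding f_def p g gbinomial_even by simp
  have o: "f (Suc (2 * k)) = \<i> * of_real ((\<nu> * \<tau>) * (tan_coeff \<nu> 1 k * (- (\<tau>\<^sup>2)) ^ k))" for k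
    unfolding f_def power_Suc p g gbinomial_odd by simp
  have "f sums (1 + \<i> * of_real \<tau>) powr of_real \<nu>"
    unfolding f_def using assms(2) by (intro gen_binomial_complex) (simp add: norm_mult)
  from sums_group[OF this, of 2]
  have "(\<lambda>k. f (2 * k) + f (Suc (2 * k))) sums ((1 + \<i> * of_real \<tau>) powr of_real \<nu>)"
    by (simp add: numeral_2_eq_2 mult.commute add.commute)
  moreover have "(\<lambda>k. f (2 * k) + f (Suc (2 * k))) sums
     (of_real (tan_series \<nu> 0 (\<tau>\<^sup>2)) + \<i> * of_real ((\<nu> * \<tau>) * tan_series \<nu> 1 (\<tau>\<^sup>2)))"
    unfolding e o by (intro sums_add sums_mult sums_of_real tan_series_sums assms y)
  ultimately have "(1 + \<i> * of_real \<tau>) powr of_real \<nu> =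
      of_real (tan_series \<nu> 0 (\<tau>\<^sup>2)) + \<i> * of_real ((\<nu> * \<tau>) * tan_series \<nu> 1 (\<tau>\<^sup>2))"
    by (rule sums_unique2)
  then show ?thesis by (simp only:) (simp add: complex_eq_iff)
qed

section \<open>Integrality\<close>

text \<open>The shape of a product of \<open>n\<close> factors \<open>\<delta> + \<i>\<close> or
  \<open>\<delta> - \<i>\<close> scaled by \<open>d ^ (n div 2)\<close>, where \<open>d\<close> and
  \<open>d * \<delta>\<^sup>2\<close> are integers. The possibly irrational \<open>\<delta>\<close>
  alternates between imaginary and real part; the extra \<open>d\<close> for even \<open>n\<close>
  stems from the scaling that turns \<open>\<delta>\<^sup>2\<close> into an integer.\<close>

definition lattice_form :: "real \<Rightarrow> real \<Rightarrow> nat \<Rightarrow> complex \<Rightarrow> bool" where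
  "lattice_form d \<delta> n z \<longleftrightarrow> (\<exists>A\<in>\<int>. \<exists>B\<in>\<int>.
     z = (if even n then Complex A (d * \<delta> * B) else Complex (A * \<delta>) B))"

lemma lattice_form_step:
  assumes "d \<in> \<int>" "d * \<delta>\<^sup>2 \<in> \<int>" "\<sigma> \<in> \<int>" and z: "lattice_form d \<delta> n z"
  shows "lattice_form d \<delta> (Suc n) ((if even n then 1 else of_real d) * z * Complex \<delta> \<sigma>)"
proof (cases "even n")
  case True
  then obtain A B where AB: "A \<in> \<int>" "B \<in> \<int>" "z = Complex A (d * \<delta> * B)"
    using z by (auto simp: lattice_form_def)
  have "z * Complex \<delta> \<sigma> = Complex ((A - \<sigma> * d * B) * \<delta>) (\<sigma> * A + (d * \<delta>\<^sup>2) * B)"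
    by (simp add: AB complex_eq_iff power2_eq_square algebra_simps)
  moreover have "A - \<sigma> * d * B \<in> \<int>" "\<sigma> * A + (d * \<delta>\<^sup>2) * B \<in> \<int>"
    using AB assms by (auto intro!: Ints_add Ints_diff Ints_mult)
  ultimately show ?thesis using True unfolding lattice_form_def by auto
next
  case False
  then obtain A B where AB: "A \<in> \<int>" "B \<in> \<int>" "z = Complex (A * \<delta>) B"
    using z by (auto simp: lattice_form_def)
  have "of_real d * z * Complex \<delta> \<sigma> = Complex (A * (d * \<delta>\<^sup>2) - \<sigma> * d * B) (d * \<delta> * (\<sigma> * A + B))"
    by (simp add: AB complex_eq_iff power2_eq_square algebra_simps)
  moreover have "A * (d * \<delta>\<^sup>2) - \<sigma> * d * B \<in> \<int>" "\<sigma> * A + B \<in> \<int>"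
    using AB assms by (auto intro!: Ints_add Ints_diff Ints_mult)
  ultimately show ?thesis using False unfolding lattice_form_def by auto
qed

lemma lattice_form_power_mult:
  assumes "d \<in> \<int>" "d * \<delta>\<^sup>2 \<in> \<int>" "\<sigma> \<in> \<int>" and z: "lattice_form d \<delta> n (of_real d ^ (n div 2) * z)"
  shows "lattice_form d \<delta> (n + k) (of_real d ^ ((n + k) div 2) * (z * Complex \<delta> \<sigma> ^ k))"
proof (induction k)
  case (Suc k)
  \<comment> \<open>A new factor \<open>d\<close> enters only on passing from an odd to an even
    number of factors.\<close>
  have "of_real d ^ (Suc m div 2) = (if even m then 1 else complex_of_real d) * of_real d ^ (m div 2)" for m :: nat
    by (cases "even m") (auto elim!: evenE oddE)
  then have "of_real d ^ ((n + Suc k) div 2) * (z * Complex \<delta> \<sigma> ^ Suc k) =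
     (if even (n + k) then 1 else of_real d) * (of_real d ^ ((n + k) div 2) * (z * Complex \<delta> \<sigma> ^ k)) * Complex \<delta> \<sigma>"
    by (simp only: add_Suc_right power_Suc) (simp only: ac_simps)
  then show ?case using lattice_form_step[OF assms(1-3) Suc] by (simp only: add_Suc_right)
qed (use z in simp)

lemma lattice_form_powers:
  assumes "d \<in> \<int>" "d * \<delta>\<^sup>2 \<in> \<int>"
  shows "lattice_form d \<delta> (k + l) (of_real d ^ ((k + l) div 2) * (Complex \<delta> 1 ^ k * Complex \<delta> (-1) ^ l))"
proof (intro lattice_form_power_mult assms)
  have "lattice_form d \<delta> 0 (of_real d ^ (0 div 2) * 1)"
    unfolding lattice_form_def by (auto intro!: bexI[of _ 1] bexI[of _ 0] simp: complex_eq_iff)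
  from lattice_form_power_mult[OF assms _ this, of 1 k]
  show "lattice_form d \<delta> k (of_real d ^ (k div 2) * Complex \<delta> 1 ^ k)" by simp
qed auto

lemma lattice_form_add:
  assumes "lattice_form d \<delta> n z" "lattice_form d \<delta> n z'"
  shows "lattice_form d \<delta> n (z + z')"
proof -
  obtain A B A' B' where AB: "A \<in> \<int>" "B \<in> \<int>" "A' \<in> \<int>" "B' \<in> \<int>"
    "z = (if even n then Complex A (d * \<delta> * B) else Complex (A * \<delta>) B)"
    "z' = (if even n then Complex A' (d * \<delta> * B') else Complex (A' * \<delta>) B')"
    using assms unfolding lattice_form_def by blast
  have "A + A' \<in> \<int>" "B + B' \<in> \<int>" using AB by auto
  moreover have "z + z' = (if even n then Complex (A + A') (d * \<delta> * (B + B')) else Complex ((A + A') * \<delta>) (B + B'))"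
    using AB by (simp add: complex_eq_iff algebra_simps)
  ultimately show ?thesis unfolding lattice_form_def by blast
qed

lemma lattice_form_mult:
  assumes "lattice_form d \<delta> n z" "c \<in> \<int>"
  shows "lattice_form d \<delta> n (of_real c * z)"
proof -
  obtain A B where AB: "A \<in> \<int>" "B \<in> \<int>"
    "z = (if even n then Complex A (d * \<delta> * B) else Complex (A * \<delta>) B)"
    using assms unfolding lattice_form_def by blast
  have "c * A \<in> \<int>" "c * B \<in> \<int>" using AB assms by auto
  moreover have "of_real c * z = (if even n then Complex (c * A) (d * \<delta> * (c * B)) else Complex (c * A * \<delta>) (c * B))"
    using AB by (simp add: complex_eq_iff)
  ultimately show ?thesis unfolding lattice_form_def by blast
qed

lemma lattice_form_sum:
  assumes "\<And>k. k \<in> S \<Longrightarrow> lattice_form d \<delta> n (f k)"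
  shows "lattice_form d \<delta> n (\<Sum>k\<in>S. f k)"
proof -
  have "lattice_form d \<delta> n 0"
    unfolding lattice_form_def by (auto intro!: bexI[of _ 0] simp: complex_eq_iff)
  then show ?thesis using assms by (induction S rule: infinite_finite_induct) (auto intro: lattice_form_add)
qed

section \<open>Convergents\<close>

text \<open>The Jacobi recurrence at \<open>X = \<delta> + \<i>\<close> and
  \<open>Y = \<delta> - \<i>\<close>, where \<open>X + Y = 2 * \<delta>\<close> and
  \<open>(X - Y)\<^sup>2 = - 4\<close>. For \<open>\<bar>\<nu>\<bar> < 1\<close> and
  \<open>\<delta> \<ge> 0\<close> no coefficient is negative.\<close>

definition jacobi_rec :: "real \<Rightarrow> real \<Rightarrow> (nat \<Rightarrow> real) \<Rightarrow> bool" where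
  "jacobi_rec \<nu> \<delta> u \<longleftrightarrow> (\<forall>n. (real n + 1) * (real n + 2) * u (Suc (Suc n)) =
     2 * (real n + 1) * (2 * real n + 3) * \<delta> * u (Suc n) + 4 * ((real n + 1)\<^sup>2 - \<nu>\<^sup>2) * u n)"

text \<open>The quotient of \<open>conv_im\<close> by \<open>conv_re\<close> approximates tan(\<nu>
  \<theta>), where tan \<theta> = \<open>1 / \<delta>\<close>.\<close>

definition conv_re :: "real \<Rightarrow> real \<Rightarrow> nat \<Rightarrow> real" where
  "conv_re \<nu> \<delta> n = Re (jacobi_form \<nu> n (Complex \<delta> 1) (Complex \<delta> (-1)))"

definition conv_im :: "real \<Rightarrow> real \<Rightarrow> nat \<Rightarrow> real" where
  "conv_im \<nu> \<delta> n = Im (jacobi_form \<nu> n (Complex \<delta> 1) (Complex \<delta> (-1)))"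

lemma conv_0 [simp]: "conv_re \<nu> \<delta> 0 = 1" "conv_im \<nu> \<delta> 0 = 0"
  by (simp_all add: conv_re_def conv_im_def jacobi_form_def jacobi_coeff_def)

lemma conv_1 [simp]: "conv_re \<nu> \<delta> (Suc 0) = 2 * \<delta>" "conv_im \<nu> \<delta> (Suc 0) = 2 * \<nu>"
  by (simp_all add: conv_re_def conv_im_def jacobi_form_def jacobi_coeff_def algebra_simps)

lemma jacobi_rec_conv:
  assumes "\<bar>\<nu>\<bar> < 1"
  shows "jacobi_rec \<nu> \<delta> (conv_re \<nu> \<delta>)" "jacobi_rec \<nu> \<delta> (conv_im \<nu> \<delta>)"
proof -
  let ?J = "\<lambda>n. jacobi_form \<nu> n (Complex \<delta> 1) (Complex \<delta> (-1))"
  have XY: "Complex \<delta> 1 + Complex \<delta> (-1) = of_real (2 * \<delta>)"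
    "(Complex \<delta> 1 - Complex \<delta> (-1))\<^sup>2 = of_real (-4)"
    by (simp_all add: complex_eq_iff power2_eq_square)
  have "of_real (real (Suc n) * real (Suc (Suc n))) * ?J (Suc (Suc n)) =
      of_real (real (Suc n) * real (2 * n + 3) * (2 * \<delta>)) * ?J (Suc n)
      - of_real (((real n + 1)\<^sup>2 - \<nu>\<^sup>2) * (-4)) * ?J n" for n
    using jacobi_form_recurrence[OF assms, of "Complex \<delta> (-1)" n "Complex \<delta> 1"] unfolding XY
    by (simp add: complex_eq_iff)
  from arg_cong[OF this, of Re] arg_cong[OF this, of Im]
  have "real (Suc n) * real (Suc (Suc n)) * Re (?J (Suc (Suc n))) =
      real (Suc n) * real (2 * n + 3) * (2 * \<delta>) * Re (?J (Suc n)) - ((real n + 1)\<^sup>2 - \<nu>\<^sup>2) * (-4) * Re (?J n)"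
    "real (Suc n) * real (Suc (Suc n)) * Im (?J (Suc (Suc n))) =
      real (Suc n) * real (2 * n + 3) * (2 * \<delta>) * Im (?J (Suc n)) - ((real n + 1)\<^sup>2 - \<nu>\<^sup>2) * (-4) * Im (?J n)" for n
    by (simp_all only: Re_complex_of_real Im_complex_of_real times_complex.sel minus_complex.sel mult_zero_left diff_0_right add_0_right)
  then show "jacobi_rec \<nu> \<delta> (conv_re \<nu> \<delta>)" "jacobi_rec \<nu> \<delta> (conv_im \<nu> \<delta>)"
    unfolding jacobi_rec_def conv_re_def conv_im_def by (simp_all add: algebra_simps)
qed

lemma jacobi_rec_lincomb:
  assumes "jacobi_rec \<nu> \<delta> u" "jacobi_rec \<nu> \<delta> w"
  shows "jacobi_rec \<nu> \<delta> (\<lambda>n. c * u n - e * w n)"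
  unfolding jacobi_rec_def
proof
  fix n
  let ?p = "(real n + 1) * (real n + 2)"
  have "?p * (c * u (Suc (Suc n)) - e * w (Suc (Suc n))) = c * (?p * u (Suc (Suc n))) - e * (?p * w (Suc (Suc n)))"
    by (simp add: algebra_simps)
  also have "\<dots> = 2 * (real n + 1) * (2 * real n + 3) * \<delta> * (c * u (Suc n) - e * w (Suc n))
      + 4 * ((real n + 1)\<^sup>2 - \<nu>\<^sup>2) * (c * u n - e * w n)"
    unfolding assms[unfolded jacobi_rec_def, rule_format] by (simp add: algebra_simps)
  finally show "?p * (c * u (Suc (Suc n)) - e * w (Suc (Suc n))) =
      2 * (real n + 1) * (2 * real n + 3) * \<delta> * (c * u (Suc n) - e * w (Suc n))
      + 4 * ((real n + 1)\<^sup>2 - \<nu>\<^sup>2) * (c * u n - e * w n)" .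
qed

lemma jacobi_rec_unique:
  assumes "jacobi_rec \<nu> \<delta> u" "jacobi_rec \<nu> \<delta> w" "u 0 = w 0" "u (Suc 0) = w (Suc 0)"
  shows "u n = w n"
proof (induction n rule: induct_nat_012)
  case (ge2 n)
  have "(real n + 1) * (real n + 2) * u (Suc (Suc n)) = (real n + 1) * (real n + 2) * w (Suc (Suc n))"
    unfolding assms(1,2)[unfolded jacobi_rec_def, rule_format] ge2 ..
  then show ?case by simp
qed (use assms in simp_all)

section \<open>Positivity, growth and determinants of the solutions\<close>

lemma sq_less_Suc_sq:
  assumes "\<bar>\<nu>\<bar> < (1::real)"
  shows "\<nu>\<^sup>2 < (real n + 1)\<^sup>2"
proof -
  have "\<nu>\<^sup>2 < 1" using assms by (simp add: abs_square_less_1)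
  also have "1 \<le> (real n + 1)\<^sup>2" by simp
  finally show ?thesis .
qed

lemma jacobi_rec_nonneg:
  assumes "jacobi_rec \<nu> \<delta> u" "\<bar>\<nu>\<bar> < 1" "\<delta> \<ge> 0" "u 0 \<ge> 0" "u (Suc 0) \<ge> 0"
  shows "u n \<ge> 0"
proof (induction n rule: induct_nat_012)
  case (ge2 n)
  have "(real n + 1) * (real n + 2) * u (Suc (Suc n)) \<ge> 0"
    unfolding assms(1)[unfolded jacobi_rec_def, rule_format]
    using ge2 assms(3) sq_less_Suc_sq[OF assms(2), of n] by (intro add_nonneg_nonneg mult_nonneg_nonneg) auto
  moreover have "(real n + 1) * (real n + 2) > 0" by (simp add: add_pos_pos)
  ultimately show ?case by (metis mult_pos_neg not_le)
qed (use assms in simp_all)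

lemma conv_re_nonneg:
  assumes "\<bar>\<nu>\<bar> < 1" "\<delta> \<ge> 0"
  shows "conv_re \<nu> \<delta> n \<ge> 0"
  by (rule jacobi_rec_nonneg[OF jacobi_rec_conv(1)]) (use assms in auto)

lemma conv_im_nonneg:
  assumes "0 \<le> \<nu>" "\<nu> < 1" "\<delta> \<ge> 0"
  shows "conv_im \<nu> \<delta> n \<ge> 0"
  by (rule jacobi_rec_nonneg[OF jacobi_rec_conv(2)]) (use assms in auto)

text \<open>The difference of the two sides solves the same recurrence with initial values
  \<open>\<nu> / \<delta>\<close> and 0, so it stays nonnegative.\<close>

lemma conv_im_le:
  assumes "0 \<le> \<nu>" "\<nu> < 1" "\<delta> > 0"
  shows "conv_im \<nu> \<delta> n \<le> \<nu> / \<delta> * conv_re \<nu> \<delta> n"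
proof -
  have "\<nu> / \<delta> * conv_re \<nu> \<delta> n - 1 * conv_im \<nu> \<delta> n \<ge> 0"
    by (rule jacobi_rec_nonneg[OF jacobi_rec_lincomb[OF jacobi_rec_conv]]) (use assms in auto)
  then show ?thesis by simp
qed

text \<open>Divided by \<open>(n + 1) * (n + 2)\<close>, the recurrence has coefficients at most
  \<open>4 * \<delta>\<close> and 4, so growth with ratio \<open>r\<close> is possible to bound once
  \<open>4 * \<delta> * r + 4 \<le> r\<^sup>2\<close>. The present \<open>r\<close> has
  \<open>r\<^sup>2 = 16 * s ^ 3\<close> when \<open>\<delta>\<^sup>2 = s ^ 3 - 1\<close>.\<close>

lemma conv_re_le:
  assumes "\<bar>\<nu>\<bar> < 1" "\<delta> \<ge> 0"
  shows "conv_re \<nu> \<delta> n \<le> (4 * sqrt (\<delta>\<^sup>2 + 1)) ^ n"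
proof (induction n rule: induct_nat_012)
  case 1
  have "\<delta> \<le> sqrt (\<delta>\<^sup>2 + 1)" using assms(2) by (intro real_le_rsqrt) simp
  then show ?case using assms(2) by simp
next
  case (ge2 n)
  define r where "r = 4 * sqrt (\<delta>\<^sup>2 + 1)"
  have r0: "r > 0" unfolding r_def using assms by (simp add: add_nonneg_pos)
  have r: "4 * \<delta> * r + 4 \<le> r\<^sup>2"
  proof -
    let ?s = "sqrt (\<delta>\<^sup>2 + 1)"
    have s2: "?s\<^sup>2 = \<delta>\<^sup>2 + 1" by simp
    have "(?s - \<delta>)\<^sup>2 \<ge> 0" by simp
    then have "2 * \<delta> * ?s \<le> \<delta>\<^sup>2 + ?s\<^sup>2" by (simp add: power2_diff algebra_simps)
    then show ?thesis unfolding r_def power_mult_distrib s2 by (simp add: mult_ac)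
  qed
  have nn: "conv_re \<nu> \<delta> n \<ge> 0" "conv_re \<nu> \<delta> (Suc n) \<ge> 0" using conv_re_nonneg[OF assms] by auto
  let ?p = "(real n + 1) * (real n + 2)"
  have "2 * (real n + 1) * (2 * real n + 3) \<le> ?p * 4" by (simp add: algebra_simps)
  from mult_right_mono[OF this assms(2)]
  have 1: "2 * (real n + 1) * (2 * real n + 3) * \<delta> \<le> ?p * (4 * \<delta>)" by (simp add: mult_ac)
  have "(real n + 1)\<^sup>2 - \<nu>\<^sup>2 \<le> (real n + 1)\<^sup>2" by simp
  also have "\<dots> \<le> ?p" unfolding power2_eq_square by (intro mult_left_mono) auto
  finally have 2: "4 * ((real n + 1)\<^sup>2 - \<nu>\<^sup>2) \<le> ?p * 4" by simp
  have "?p * conv_re \<nu> \<delta> (Suc (Suc n)) =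
     2 * (real n + 1) * (2 * real n + 3) * \<delta> * conv_re \<nu> \<delta> (Suc n) + 4 * ((real n + 1)\<^sup>2 - \<nu>\<^sup>2) * conv_re \<nu> \<delta> n"
    using jacobi_rec_conv(1)[OF assms(1)] unfolding jacobi_rec_def by blast
  also have "\<dots> \<le> (?p * (4 * \<delta>)) * r ^ Suc n + (?p * 4) * r ^ n"
    by (intro add_mono mult_mono[OF 1] mult_mono[OF 2]) (use ge2 nn assms in \<open>auto simp: r_def\<close>)
  also have "\<dots> = ?p * ((4 * \<delta> * r + 4) * r ^ n)" by (simp add: algebra_simps)
  also have "\<dots> \<le> ?p * (r\<^sup>2 * r ^ n)" using r r0 by (intro mult_left_mono mult_right_mono) auto
  also have "\<dots> = ?p * r ^ Suc (Suc n)" by (simp add: power2_eq_square)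
  finally show ?case unfolding r_def[symmetric] by (subst (asm) mult_le_cancel_left_pos) (auto intro!: mult_pos_pos)
qed simp

text \<open>The Casoratian of the two solutions starts at \<open>2 * \<nu>\<close>, and each step
  multiplies it by a nonzero factor.\<close>

lemma conv_det:
  assumes "\<bar>\<nu>\<bar> < 1" "\<nu> \<noteq> 0"
  shows "conv_re \<nu> \<delta> n * conv_im \<nu> \<delta> (Suc n) - conv_re \<nu> \<delta> (Suc n) * conv_im \<nu> \<delta> n \<noteq> 0"
proof (induction n)
  case (Suc n)
  let ?R = "conv_re \<nu> \<delta>" and ?I = "conv_im \<nu> \<delta>" and ?p = "(real n + 1) * (real n + 2)"
  have "?p * (?R (Suc n) * ?I (Suc (Suc n)) - ?R (Suc (Suc n)) * ?I (Suc n)) =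
     ?R (Suc n) * (?p * ?I (Suc (Suc n))) - (?p * ?R (Suc (Suc n))) * ?I (Suc n)" by (simp add: algebra_simps)
  also have "\<dots> = - (4 * ((real n + 1)\<^sup>2 - \<nu>\<^sup>2)) * (?R n * ?I (Suc n) - ?R (Suc n) * ?I n)"
    unfolding jacobi_rec_conv[OF assms(1), unfolded jacobi_rec_def, rule_format] by algebra
  also have "\<dots> \<noteq> 0" using Suc sq_less_Suc_sq[OF assms(1), of n] by simp
  finally show ?case by auto
qed (use assms in simp)

text \<open>Only odd indices yield approximations with the right integrality, hence the gap of two.
  One use of the recurrence reduces it to the Casoratian.\<close>

lemma conv_det2:
  assumes "\<bar>\<nu>\<bar> < 1" "\<nu> \<noteq> 0" "\<delta> \<noteq> 0"
  shows "conv_re \<nu> \<delta> n * conv_im \<nu> \<delta> (n + 2) - conv_re \<nu> \<delta> (n + 2) * conv_im \<nu> \<delta> n \<noteq> 0"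
proof -
  let ?R = "conv_re \<nu> \<delta>" and ?I = "conv_im \<nu> \<delta>" and ?p = "(real n + 1) * (real n + 2)"
  have "?p * (?R n * ?I (Suc (Suc n)) - ?R (Suc (Suc n)) * ?I n) =
     ?R n * (?p * ?I (Suc (Suc n))) - (?p * ?R (Suc (Suc n))) * ?I n" by (simp add: algebra_simps)
  also have "\<dots> = (2 * (real n + 1) * (2 * real n + 3) * \<delta>) * (?R n * ?I (Suc n) - ?R (Suc n) * ?I n)"
    unfolding jacobi_rec_conv[OF assms(1), unfolded jacobi_rec_def, rule_format] by algebra
  also have "\<dots> \<noteq> 0" using conv_det[OF assms(1,2), of \<delta> n] assms(3)
    by (simp add: add_nonneg_eq_0_iff)
  finally show ?thesis by auto
qed

text \<open>The leading coefficient of the remainder in powers of \<open>1 / \<delta>\<close>; the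
  recursion is the one that matches the contiguous relation with the Jacobi recurrence.\<close>

fun remainder_coeff :: "real \<Rightarrow> nat \<Rightarrow> real" where
  "remainder_coeff \<nu> 0 = \<nu>"
| "remainder_coeff \<nu> (Suc n) =
     - (2 * ((real n + 1)\<^sup>2 - \<nu>\<^sup>2) / ((real n + 1) * (2 * real n + 3))) * remainder_coeff \<nu> n"

lemma abs_remainder_coeff_le:
  assumes "\<bar>\<nu>\<bar> < 1"
  shows "\<bar>remainder_coeff \<nu> n\<bar> \<le> \<bar>\<nu>\<bar>"
proof (induction n)
  case (Suc n)
  have "\<bar>2 * ((real n + 1)\<^sup>2 - \<nu>\<^sup>2)\<bar> = 2 * ((real n + 1)\<^sup>2 - \<nu>\<^sup>2)"
    using sq_less_Suc_sq[OF assms, of n] by simp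
  also have "\<dots> \<le> 2 * (real n + 1)\<^sup>2" by simp
  also have "\<dots> \<le> (real n + 1) * (2 * real n + 3)" by (simp add: power2_eq_square algebra_simps)
  finally have "\<bar>2 * ((real n + 1)\<^sup>2 - \<nu>\<^sup>2)\<bar> / ((real n + 1) * (2 * real n + 3)) \<le> 1"
    by (simp add: divide_le_eq)
  then have "\<bar>remainder_coeff \<nu> (Suc n)\<bar> \<le> 1 * \<bar>\<nu>\<bar>"
    by (simp only: remainder_coeff.simps abs_mult abs_divide abs_minus_cancel)
      (intro mult_mono Suc, simp_all add: abs_mult)
  then show ?case by simp
qed simp

text \<open>Both sides solve the Jacobi recurrence, the right one by the contiguous relation, and
  they agree at \<open>n = 0\<close> and \<open>n = 1\<close>.\<close>

lemma remainder_eq: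
  assumes \<nu>: "\<bar>\<nu>\<bar> < 1" and \<delta>: "\<delta> > 1"
  shows "\<nu> / \<delta> * tan_series \<nu> 1 (1 / \<delta>\<^sup>2) * conv_re \<nu> \<delta> n - tan_series \<nu> 0 (1 / \<delta>\<^sup>2) * conv_im \<nu> \<delta> n
    = remainder_coeff \<nu> n / \<delta> ^ Suc n * tan_series \<nu> (Suc n) (1 / \<delta>\<^sup>2)"
proof -
  let ?F = "\<lambda>n. tan_series \<nu> n (1 / \<delta>\<^sup>2)" and ?g = "remainder_coeff \<nu>"
  have y: "0 \<le> 1 / \<delta>\<^sup>2" "1 / \<delta>\<^sup>2 < 1" using \<delta> by (auto simp: power_less_one_iff)
  have contig: "?F n = ?F (Suc n) + ((real n + 1)\<^sup>2 - \<nu>\<^sup>2) / (4 * (real n + 1)\<^sup>2 - 1) / \<delta>\<^sup>2 * ?F (Suc (Suc n))" for n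
    using tan_series_contiguous[of \<nu> "1 / \<delta>\<^sup>2" n] \<nu> y by (simp add: mult.commute)
  have rec: "jacobi_rec \<nu> \<delta> (\<lambda>n. ?g n / \<delta> ^ Suc n * ?F (Suc n))"
    unfolding jacobi_rec_def
  proof
    fix n
    let ?m = "real n + 1"
    define A where "A = ?F (Suc (Suc n))"
    define B where "B = ?F (Suc (Suc (Suc n)))"
    define G where "G = ?g n / \<delta> ^ Suc n"
    define K where "K = ?m\<^sup>2 - \<nu>\<^sup>2"
    define L where "L = (?m + 1)\<^sup>2 - \<nu>\<^sup>2"
    have m: "?m > 0" "2 * ?m + 1 > 0" "2 * ?m + 3 > 0" "?m + 1 > 0" by simp_all
    \<comment> \<open>With \<open>m = n + 1\<close>, the denominator
      \<open>4 * (m + 1)\<^sup>2 - 1\<close> factors as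
      \<open>(2 * m + 1) * (2 * m + 3)\<close>.\<close>
    have F1: "?F (Suc n) = A + L / ((2 * ?m + 1) * (2 * ?m + 3)) / \<delta>\<^sup>2 * B"
      using contig[of "Suc n"] unfolding A_def B_def L_def
      by (simp add: power2_eq_square algebra_simps)
    have gen: "c * g / (d * D) = c * (g / D) / d" for c g d D :: real by (simp add: mult_ac)
    have gen2: "- X * (- Y * H / d) / d = X * Y * H / d\<^sup>2" for X Y H d :: real
      by (simp add: power2_eq_square)
    have e: "2 * real n + 3 = 2 * ?m + 1" "2 * real (Suc n) + 3 = 2 * ?m + 3" "real (Suc n) + 1 = ?m + 1" by simp_all
    have g1: "?g (Suc n) / \<delta> ^ Suc (Suc n) = - (2 * K / (?m * (2 * ?m + 1))) * G / \<delta>"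
      unfolding G_def K_def remainder_coeff.simps e power_Suc[of \<delta> "Suc n"] gen ..
    have "?g (Suc (Suc n)) / \<delta> ^ Suc (Suc (Suc n)) =
        - (2 * L / ((?m + 1) * (2 * ?m + 3))) * (?g (Suc n) / \<delta> ^ Suc (Suc n)) / \<delta>"
      unfolding L_def remainder_coeff.simps(2)[of \<nu> "Suc n"] e power_Suc[of \<delta> "Suc (Suc n)"] gen ..
    then have g2: "?g (Suc (Suc n)) / \<delta> ^ Suc (Suc (Suc n)) =
        (2 * L / ((?m + 1) * (2 * ?m + 3))) * (2 * K / (?m * (2 * ?m + 1))) * G / \<delta>\<^sup>2"
      unfolding g1 by (simp only: gen2)
    have id: "m * (m + 1) * (2 * L' / ((m + 1) * q) * (2 * K' / (m * p)) * G' / d\<^sup>2 * B') =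
        2 * m * p * d * (- (2 * K' / (m * p)) * G' / d * A') + 4 * K' * (G' * (A' + L' / (p * q) / d\<^sup>2 * B'))"
      if "m > 0" "p > 0" "q > 0" "d > 0" for m p q d L' K' G' A' B' :: real
    proof -
      have "m * (m + 1) * (2 * L' / ((m + 1) * q) * (2 * K' / (m * p)) * G' / d\<^sup>2 * B') = 4 * K' * G' * L' * B' / (p * q * d\<^sup>2)"
        using that by (simp add: divide_simps)
      moreover have "2 * m * p * d * (- (2 * K' / (m * p)) * G' / d * A') = - (4 * K' * G' * A')"
        using that by (simp add: divide_simps)
      moreover have "4 * K' * (G' * (A' + L' / (p * q) / d\<^sup>2 * B')) = 4 * K' * G' * A' + 4 * K' * G' * L' * B' / (p * q * d\<^sup>2)"
        using that by (simp add: divide_simps) (simp add: algebra_simps)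
      ultimately show ?thesis by simp
    qed
    have "?m * (?m + 1) * (?g (Suc (Suc n)) / \<delta> ^ Suc (Suc (Suc n)) * B) =
       2 * ?m * (2 * ?m + 1) * \<delta> * (?g (Suc n) / \<delta> ^ Suc (Suc n) * A) + 4 * K * (G * ?F (Suc n))"
      unfolding F1 g1 g2 by (rule id) (use \<delta> m in auto)
    moreover have "?m + 1 = real n + 2" "2 * ?m + 1 = 2 * real n + 3" by simp_all
    ultimately show "(real n + 1) * (real n + 2) * (?g (Suc (Suc n)) / \<delta> ^ Suc (Suc (Suc n)) * ?F (Suc (Suc (Suc n)))) =
      2 * (real n + 1) * (2 * real n + 3) * \<delta> * (?g (Suc n) / \<delta> ^ Suc (Suc n) * ?F (Suc (Suc n)))
      + 4 * ((real n + 1)\<^sup>2 - \<nu>\<^sup>2) * (?g n / \<delta> ^ Suc n * ?F (Suc n))"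
      unfolding A_def B_def G_def K_def by (simp only:)
  qed
  have init: "2 * \<delta> * (\<nu> / \<delta> * ?F 1) - ?F 0 * (2 * \<nu>) = ?g (Suc 0) / \<delta> ^ Suc (Suc 0) * ?F (Suc (Suc 0))"
  proof -
    have "?F 0 = ?F 1 + (1 - \<nu>\<^sup>2) / 3 / \<delta>\<^sup>2 * ?F (Suc (Suc 0))" using contig[of 0] by simp
    then show ?thesis using \<delta> by (simp only:) (simp add: field_simps power2_eq_square)
  qed
  show ?thesis
  proof (rule jacobi_rec_unique[OF jacobi_rec_lincomb[OF jacobi_rec_conv[OF \<nu>]] rec])
    show "\<nu> / \<delta> * ?F 1 * conv_re \<nu> \<delta> (Suc 0) - ?F 0 * conv_im \<nu> \<delta> (Suc 0) =
        ?g (Suc 0) / \<delta> ^ Suc (Suc 0) * ?F (Suc (Suc 0))"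
      using init by (simp only: conv_1 mult_ac)
  qed simp
qed

section \<open>The cubic case\<close>

text \<open>The upper arguments are \<open>(3 * n + 1) / 3\<close> and
  \<open>(3 * n - 1) / 3\<close>, and the powers of 3 for the two binomials fit together because
  \<open>k div 2 + (n - k) div 2 \<le> n div 2\<close>.\<close>

lemma jacobi_coeff_third_integral:
  assumes "k \<le> n"
  shows "3 ^ (n + n div 2) * jacobi_coeff (1 / 3) n k \<in> \<int>"
proof -
  have 1: "real n + 1 / 3 = of_int (3 * int n + 1) / 3" and 2: "real n - 1 / 3 = of_int (3 * int n - 1) / 3"
    by simp_all
  define e where "e = n + n div 2 - (k + k div 2) - (n - k + (n - k) div 2)"
  have "k div 2 + (n - k) div 2 \<le> (k + (n - k)) div 2" by simp
  then have e: "n + n div 2 = e + (k + k div 2) + (n - k + (n - k) div 2)"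
    using assms unfolding e_def by simp
  have "3 ^ e * (3 ^ (k + k div 2) * (of_int (3 * int n + 1) / 3 gchoose k)) *
      (3 ^ (n - k + (n - k) div 2) * (of_int (3 * int n - 1) / 3 gchoose (n - k))) \<in> (\<int> :: real set)"
    by (intro Ints_mult third_gbinomial_integral Ints_power) simp
  then show ?thesis unfolding jacobi_coeff_def 1 2 e power_add by (simp only: mult_ac)
qed

lemma jacobi_form_third_lattice:
  assumes "d \<in> \<int>" "d * \<delta>\<^sup>2 \<in> \<int>"
  shows "lattice_form d \<delta> n (of_real (3 ^ (n + n div 2) * d ^ (n div 2)) *
     jacobi_form (1 / 3) n (Complex \<delta> 1) (Complex \<delta> (-1)))"
proof -
  have eq: "of_real (3 ^ (n + n div 2) * d ^ (n div 2)) * jacobi_form (1 / 3) n (Complex \<delta> 1) (Complex \<delta> (-1)) =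
     (\<Sum>k\<le>n. of_real (3 ^ (n + n div 2) * jacobi_coeff (1 / 3) n k) *
        (of_real d ^ (n div 2) * (Complex \<delta> 1 ^ k * Complex \<delta> (-1) ^ (n - k))))"
    unfolding jacobi_form_def sum_distrib_left by (intro sum.cong refl) (simp add: mult_ac)
  have "lattice_form d \<delta> n (of_real d ^ (n div 2) * (Complex \<delta> 1 ^ k * Complex \<delta> (-1) ^ (n - k)))"
    if "k \<le> n" for k
    using lattice_form_powers[OF assms, of k "n - k"] that by simp
  then show ?thesis unfolding eq
    by (intro lattice_form_sum lattice_form_mult jacobi_coeff_third_integral) auto
qed

text \<open>For \<open>n = 2 * j + 1\<close> the exponents are
  \<open>n + n div 2 = 3 * j + 1\<close> and \<open>n div 2 = j\<close>. Odd \<open>n\<close> puts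
  \<open>\<delta>\<close> into the real part, hence the division.\<close>

lemma conv_third_integral:
  assumes "d \<in> \<int>" "d * \<delta>\<^sup>2 \<in> \<int>" "\<delta> \<noteq> 0"
  shows "3 * (27 * d) ^ j * conv_re (1 / 3) \<delta> (2 * j + 1) / \<delta> \<in> \<int>"
    and "3 * (27 * d) ^ j * conv_im (1 / 3) \<delta> (2 * j + 1) \<in> \<int>"
proof -
  let ?n = "2 * j + 1"
  have "?n + ?n div 2 = Suc (3 * j)" "?n div 2 = j" by simp_all
  then have c: "3 ^ (?n + ?n div 2) * d ^ (?n div 2) = 3 * (27 * d) ^ j"
    by (simp add: power_mult power_mult_distrib)
  obtain A B where AB: "A \<in> \<int>" "B \<in> \<int>"
    "of_real (3 * (27 * d) ^ j) * jacobi_form (1 / 3) ?n (Complex \<delta> 1) (Complex \<delta> (-1)) = Complex (A * \<delta>) B"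
    using jacobi_form_third_lattice[OF assms(1,2), of ?n] unfolding lattice_form_def c by auto
  from arg_cong[OF AB(3), of Re] arg_cong[OF AB(3), of Im]
  have "3 * (27 * d) ^ j * conv_re (1 / 3) \<delta> ?n = A * \<delta>" "3 * (27 * d) ^ j * conv_im (1 / 3) \<delta> ?n = B"
    unfolding conv_re_def conv_im_def
    by (simp_all only: Re_complex_of_real Im_complex_of_real times_complex.sel mult_zero_left diff_0_right add_0_right complex.sel)
  then show "3 * (27 * d) ^ j * conv_re (1 / 3) \<delta> ?n / \<delta> \<in> \<int>" "3 * (27 * d) ^ j * conv_im (1 / 3) \<delta> ?n \<in> \<int>"
    using AB assms(3) by simp_all
qed

text \<open>With \<open>f\<^sub>0 + \<i> f\<^sub>1\<close> the principal cube root of \<open>1 + \<i> / \<delta>\<close>, the number \<open>m = \<delta> f\<^sub>1 / f\<^sub>0\<close>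
  is \<open>tan (\<theta> / 3) / tan \<theta>\<close> where \<open>tan \<theta> = 1 / \<delta>\<close>; the triple angle formula turns into this cubic.\<close>

lemma tan_third_cubic:
  assumes "\<delta> > 1" "\<delta>\<^sup>2 = s ^ 3 - 1"
  defines "F \<equiv> \<lambda>n. tan_series (1 / 3) n (1 / \<delta>\<^sup>2)"
  assumes "F 0 \<noteq> 0"
  defines "m \<equiv> F 1 / (3 * F 0)"
  shows "s ^ 3 * (1 - 3 * m) = (1 - m) ^ 3"
proof -
  let ?\<zeta> = "(1 + \<i> * complex_of_real (1 / \<delta>)) powr of_real (1 / 3)"
  have "1 + \<i> * complex_of_real (1 / \<delta>) \<noteq> 0" by (simp add: complex_eq_iff)
  then have "?\<zeta> ^ 3 = 1 + \<i> * complex_of_real (1 / \<delta>)"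
    using exp_of_nat_mult[of 3 "of_real (1 / 3) * ln (1 + \<i> * complex_of_real (1 / \<delta>))"]
    by (simp add: powr_def)
  moreover have "?\<zeta> = Complex (F 0) (F 0 * m / \<delta>)"
    using binomial_powr_tan_series[of "1 / 3" "1 / \<delta>"] assms
    by (simp add: power_divide)
  ultimately have "Complex (F 0) (F 0 * m / \<delta>) ^ 3 = 1 + \<i> * complex_of_real (1 / \<delta>)"
    by (simp only:)
  also have "\<dots> = Complex 1 (1 / \<delta>)" by (simp add: complex_eq_iff)
  finally have *: "Complex (F 0) (F 0 * m / \<delta>) ^ 3 = Complex 1 (1 / \<delta>)" .
  have cube: "Complex u v ^ 3 = Complex (u ^ 3 - 3 * u * v\<^sup>2) (3 * u\<^sup>2 * v - v ^ 3)" for u v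
    by (simp add: complex_eq_iff power3_eq_cube power2_eq_square algebra_simps)
  \<comment> \<open>\<open>w\<close> is tan(\<theta> / 3); the real and imaginary parts of the cube
    then allow \<open>F 0\<close> to be eliminated.\<close>
  define w where "w = m / \<delta>"
  have m: "m = \<delta> * w" using assms(1) by (simp add: w_def)
  have "F 0 * m / \<delta> = F 0 * w" by (simp add: w_def)
  from *[unfolded this] have 1: "F 0 ^ 3 - 3 * F 0 * (F 0 * w)\<^sup>2 = 1"
    and 2: "3 * (F 0)\<^sup>2 * (F 0 * w) - (F 0 * w) ^ 3 = 1 / \<delta>"
    unfolding cube complex.inject by blast+
  have "F 0 ^ 3 * (1 - 3 * w\<^sup>2) = 1" using 1 by algebra
  moreover have "F 0 ^ 3 * (3 * w - w ^ 3) * \<delta> = 1"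
  proof -
    have "F 0 ^ 3 * (3 * w - w ^ 3) = 1 / \<delta>" using 2 by algebra
    then show ?thesis using assms(1) by simp
  qed
  ultimately have "F 0 ^ 3 * (1 - 3 * w\<^sup>2 - (3 * w - w ^ 3) * \<delta>) = 0" by algebra
  then have "1 - 3 * w\<^sup>2 = (3 * w - w ^ 3) * \<delta>" using assms(4) by simp
  then have "\<delta>\<^sup>2 - 3 * m\<^sup>2 = 3 * m * \<delta>\<^sup>2 - m ^ 3" unfolding m by algebra
  then show ?thesis unfolding assms(2) by (simp add: power3_eq_cube power2_eq_square algebra_simps)
qed

text \<open>The candidate \<open>t * s / D\<close> satisfies the cubic equation, and
  \<open>m < 1\<close> gives \<open>D < 2 * s\<close>, which places it above \<open>t / 2\<close>.
  Uniqueness of the root there does the rest.\<close>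

lemma cubic_root_param:
  fixes a t s m :: real
  assumes "a > 0" "t > 0" "t\<^sup>2 = a * (s - 1)" "0 < m" "m < 1" "s ^ 3 * (1 - 3 * m) = (1 - m) ^ 3"
    and x: "3 * x ^ 3 - 3 * t * x\<^sup>2 - 3 * a * x + a * t = 0" "x > t / 2"
  shows "x = t * s / (s - 1 + m)"
proof -
  have "a * (s - 1) > 0" using assms(2,3) by (metis zero_less_power)
  then have s: "s > 1" using assms(1) by (simp add: zero_less_mult_iff)
  define D where "D = s - 1 + m"
  have D: "D > 0" using s assms(4) by (simp add: D_def)
  define z where "z = t * s / D"
  have "D < 2 * s" using s assms(5) by (simp add: D_def)
  then have "z > t / 2" using D assms(2) by (simp add: z_def field_simps)
  moreover have "3 * z ^ 3 - 3 * t * z\<^sup>2 - 3 * a * z + a * t = 0"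
  proof -
    \<comment> \<open>In terms of \<open>m\<close>, the left side is exactly
      \<open>s ^ 3 * (1 - 3 * m) - (1 - m) ^ 3\<close>.\<close>
    have "3 * (s - 1) * s ^ 3 - 3 * (s - 1) * s\<^sup>2 * D - 3 * s * D\<^sup>2 + D ^ 3 = 0"
      using assms(6) unfolding D_def by (simp add: power3_eq_cube power2_eq_square algebra_simps)
    moreover have "3 * (t * s) ^ 3 - 3 * t * (t * s)\<^sup>2 * D - 3 * a * (t * s) * D\<^sup>2 + a * t * D ^ 3 =
       t * (3 * t\<^sup>2 * s ^ 3 - 3 * t\<^sup>2 * s\<^sup>2 * D - 3 * a * s * D\<^sup>2 + a * D ^ 3)"
      by (simp add: power3_eq_cube power2_eq_square algebra_simps)
    moreover have "\<dots> = t * a * (3 * (s - 1) * s ^ 3 - 3 * (s - 1) * s\<^sup>2 * D - 3 * s * D\<^sup>2 + D ^ 3)"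
      unfolding assms(3) by (simp add: algebra_simps)
    ultimately have "3 * (t * s) ^ 3 - 3 * t * (t * s)\<^sup>2 * D - 3 * a * (t * s) * D\<^sup>2 + a * t * D ^ 3 = 0"
      by simp
    moreover have "t * s = z * D" using D by (simp add: z_def)
    ultimately have "D ^ 3 * (3 * z ^ 3 - 3 * t * z\<^sup>2 - 3 * a * z + a * t) = 0" by algebra
    then show ?thesis using D by simp
  qed
  ultimately show ?thesis using ex1_cubic_root[OF assms(1,2)] x unfolding D_def[symmetric] z_def[symmetric] by blast
qed

lemma tan_series_01_bounds:
  assumes "0 \<le> y" "y \<le> 1 / 100"
  shows "tan_series (1 / 3) 0 y \<ge> 9 / 10" "tan_series (1 / 3) 0 y \<le> 11 / 10"
    "tan_series (1 / 3) 1 y \<ge> 9 / 10" "tan_series (1 / 3) 1 y \<le> 11 / 10"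
proof -
  have "1 / (1 - y) \<le> 1 / (99 / 100)" using assms by (intro divide_left_mono) auto
  moreover have "1 / (1 - y)\<^sup>2 \<le> 1 / (99 / 100)\<^sup>2" using assms by (intro divide_left_mono power_mono) auto
  ultimately have "1 / (1 - y) - 1 \<le> 1 / 10" "1 / (1 - y)\<^sup>2 - 1 \<le> 1 / 10" by (simp_all add: power2_eq_square)
  moreover have "\<bar>tan_series (1 / 3) 0 y - 1\<bar> \<le> 1 / (1 - y) - 1"
    "\<bar>tan_series (1 / 3) 1 y - 1\<bar> \<le> 1 / (1 - y)\<^sup>2 - 1"
    using abs_tan_series_minus_1_le[of "1 / 3" y 0] abs_tan_series_minus_1_le[of "1 / 3" y 1] assms
    by (simp_all add: numeral_2_eq_2)
  ultimately show "tan_series (1 / 3) 0 y \<ge> 9 / 10" "tan_series (1 / 3) 0 y \<le> 11 / 10"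
    "tan_series (1 / 3) 1 y \<ge> 9 / 10" "tan_series (1 / 3) 1 y \<le> 11 / 10"
    by linarith+
qed

section \<open>Constants and approximations\<close>

text \<open>The \<open>exp 1\<close> cancels the one inside \<open>c1\<close> and leaves
  \<open>exp (- 2 * S) / 3\<close> with a nonnegative prime sum \<open>S\<close>.\<close>

lemma c1_bounds: "0 < c1\<^sup>2 * (exp 1)\<^sup>2" "c1\<^sup>2 * (exp 1)\<^sup>2 \<le> 1 / 3"
proof -
  define S where "S = (\<Sum>\<^sub>\<infinity>p\<in>{p::nat. prime p \<and> p \<ge> 5}. ln (real p) / (real p * (real p - 1)))"
  have "S \<ge> 0" unfolding S_def by (rule infsum_nonneg) auto
  have *: "c1 * exp 1 = exp (- S) / sqrt 3" unfolding c1_def S_def[symmetric] by simp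
  have "c1\<^sup>2 * (exp 1)\<^sup>2 = (exp (- S))\<^sup>2 / 3"
    unfolding power_mult_distrib[symmetric] * by (simp add: power_divide)
  moreover have "(exp (- S))\<^sup>2 \<le> 1" using \<open>S \<ge> 0\<close> by (simp add: power_le_one)
  ultimately show "c1\<^sup>2 * (exp 1)\<^sup>2 \<le> 1 / 3" by simp
  have "c1 > 0" unfolding c1_def by simp
  then show "0 < c1\<^sup>2 * (exp 1)\<^sup>2" by simp
qed

lemma c6_ge:
  assumes "a > 0"
  shows "432 * (t\<^sup>2 + a) ^ 3 \<le> c6 a t"
proof -
  have "144 * (t\<^sup>2 + a) ^ 3 / (1 / 3) \<le> 144 * (t\<^sup>2 + a) ^ 3 / (c1\<^sup>2 * (exp 1)\<^sup>2)"
    using c1_bounds assms by (intro divide_left_mono) (auto intro!: mult_pos_pos)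
  then show ?thesis by (simp add: c6_def)
qed

lemma c7_le:
  assumes "a > 0"
  shows "c7 a t \<le> t ^ 4 * (t\<^sup>2 + 2 * a)\<^sup>2 / (27 * a ^ 6 * (t\<^sup>2 + a))"
proof -
  let ?N = "t ^ 4 * (t\<^sup>2 + 2 * a)\<^sup>2" and ?D = "9 * a ^ 6 * (t\<^sup>2 + a)"
  have "t\<^sup>2 + a > 0" using assms by (simp add: add_nonneg_pos)
  then have D: "?D > 0" using assms by simp
  have N: "?N \<ge> 0" by simp
  have "c7 a t = c1\<^sup>2 * (exp 1)\<^sup>2 * (?N / ?D)" by (simp add: c7_def)
  also have "\<dots> \<le> 1 / 3 * (?N / ?D)"
    by (rule mult_right_mono[OF c1_bounds(2)]) (intro divide_nonneg_pos N D)
  finally show ?thesis by simp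
qed

section \<open>Estimates in \<open>y = 1 / \<delta>\<^sup>2\<close>; \<open>s \<ge> 10\<close>
  expresses \<open>t\<^sup>2 \<ge> 9 * a\<close>\<close>

context
  fixes s y :: real
  assumes s: "s \<ge> 10" and y: "y = 1 / (s ^ 3 - 1)"
begin

lemma cube_ge_1000: "s ^ 3 \<ge> 1000"
  using power_mono[of 10 s 3] s by simp

lemma inverse_bounds: "0 < y" "y \<le> 1 / 999"
proof -
  show "0 < y" using cube_ge_1000 unfolding y by simp
  have "1 / (s ^ 3 - 1) \<le> 1 / 999" using cube_ge_1000 by (intro divide_left_mono) auto
  then show "y \<le> 1 / 999" by (simp add: y)
qed

text \<open>This is the part of the remainder bound that does not depend on
  \<open>j\<close>.\<close>

lemma inverse_over_cube_le: "y / (1 - y) ^ 3 \<le> 6 / 5 / s ^ 3"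
proof -
  have "(99 / 100) ^ 3 \<le> (1 - y) ^ 3" using inverse_bounds by (intro power_mono) auto
  then have *: "97 / 100 \<le> (1 - y) ^ 3" by (simp add: power3_eq_cube)
  have "1 / (s ^ 3 - 1) \<le> 1 / (9 / 10 * s ^ 3)" using s cube_ge_1000
    by (intro divide_left_mono mult_pos_pos) auto
  then have "y \<le> 10 / 9 / s ^ 3" by (simp add: y)
  then have "y / (1 - y) ^ 3 \<le> (10 / 9 / s ^ 3) / (97 / 100)"
    using * inverse_bounds s by (intro frac_le) auto
  also have "\<dots> = 1000 / 873 / s ^ 3" by simp
  also have "\<dots> \<le> 6 / 5 / s ^ 3" using s by (intro divide_right_mono) auto
  finally show ?thesis .
qed

text \<open>The left side is the decay factor per step of \<open>j\<close> times the upper bound for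
  \<open>c7\<close>, rewritten in \<open>s\<close>. Cleared of denominators, the inequality has the
  slack displayed in the proof.\<close>

lemma inverse_over_square_le: "(s\<^sup>2 - 1)\<^sup>2 / s * (y / (1 - y)\<^sup>2) \<le> 1"
proof -
  have p: "s ^ 3 - 1 > 0" "s ^ 3 - 2 > 0" "s > 0" using cube_ge_1000 s by auto
  have "1 - y = (s ^ 3 - 2) / (s ^ 3 - 1)" unfolding y using p by (simp add: field_simps)
  then have *: "y / (1 - y)\<^sup>2 = (s ^ 3 - 1) / (s ^ 3 - 2)\<^sup>2"
    unfolding y using p by (simp add: power_divide power2_eq_square)
  have "(s ^ 3 - 1) * (s\<^sup>2 - 1)\<^sup>2 \<le> s * (s ^ 3 - 2)\<^sup>2"
  proof -
    have 1: "s\<^sup>2 \<ge> 10 * s" using s by (simp add: power2_eq_square)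
    have 2: "s ^ 3 \<ge> 10 * s\<^sup>2" using s mult_right_mono[of 10 s "s\<^sup>2"] by (simp add: power3_eq_cube power2_eq_square)
    have "2 * s ^ 3 - 3 * s\<^sup>2 - s - 2 \<ge> 0" using 1 2 s by linarith
    then have "s\<^sup>2 * (2 * s ^ 3 - 3 * s\<^sup>2 - s - 2) \<ge> 0" by (intro mult_nonneg_nonneg) auto
    moreover have "s * (s ^ 3 - 2)\<^sup>2 - (s ^ 3 - 1) * (s\<^sup>2 - 1)\<^sup>2 = s\<^sup>2 * (2 * s ^ 3 - 3 * s\<^sup>2 - s - 2) + 4 * s + 1"
      by algebra
    ultimately show ?thesis using s by linarith
  qed
  then show ?thesis unfolding * using p by (simp add: divide_le_eq mult.commute)
qed

end

text \<open>In \<open>x = T * s / (s - 1 + m)\<close> the number \<open>m\<close> is replaced by its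
  approximation \<open>\<iota> j / \<rho> j\<close>. Multiplying numerator and denominator by
  \<open>A * \<rho> j\<close> and by the common denominator \<open>N j\<close> gives the integers
  \<open>P j\<close> and \<open>Q j\<close>.\<close>

lemma approximants:
  fixes a t :: nat and x :: real
  assumes "a > 0" and "t > 0" and "t\<^sup>2 \<ge> 9 * a"
    and "3 * x ^ 3 - 3 * real t * x\<^sup>2 - 3 * real a * x + real a * real t = 0"
    and "x > real t / 2"
  defines "s \<equiv> ((real t)\<^sup>2 + real a) / real a"
  defines "y \<equiv> 1 / (s ^ 3 - 1)"
  obtains P Q :: "nat \<Rightarrow> int" where
    "\<And>j. 0 \<le> Q j"
    "\<And>j. real_of_int (Q j) \<le> 8 * (3 * (real t)\<^sup>2 + real a) * (432 * ((real t)\<^sup>2 + real a) ^ 3) ^ j"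
    "\<And>j. \<bar>of_int (Q j) * x - of_int (P j)\<bar> \<le>
       2 * real a * real t / s ^ 3 * (27 * real a ^ 3 * (y / (1 - y)\<^sup>2)) ^ j"
    "\<And>j. Q j * P (Suc j) \<noteq> Q (Suc j) * P j"
proof -
  define A T where "A = real a" and "T = real t"
  have AT: "A > 0" "T > 0" using assms by (simp_all add: A_def T_def)
  have T2: "T\<^sup>2 \<ge> 9 * A"
    using assms(3) unfolding A_def T_def by (metis of_nat_le_iff of_nat_mult of_nat_numeral of_nat_power)
  have s: "s \<ge> 10" using T2 AT unfolding s_def A_def[symmetric] T_def[symmetric] by (simp add: field_simps)
  have sA: "T\<^sup>2 = A * (s - 1)" "T\<^sup>2 + A = A * s"
    using AT unfolding s_def A_def[symmetric] T_def[symmetric] by (simp_all add: field_simps)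
  note yb = inverse_bounds[OF s y_def[THEN meta_eq_to_obj_eq]]
  have s3: "s ^ 3 \<ge> 1000" using cube_ge_1000[OF s y_def[THEN meta_eq_to_obj_eq]] .
  define \<delta> where "\<delta> = sqrt (s ^ 3 - 1)"
  have \<delta>2: "\<delta>\<^sup>2 = s ^ 3 - 1" and \<delta>: "\<delta> > 1" using s3 by (simp_all add: \<delta>_def)
  have y\<delta>: "1 / \<delta>\<^sup>2 = y" by (simp add: \<delta>2 y_def)
  \<comment> \<open>This choice makes
    \<open>d * \<delta>\<^sup>2 = (T\<^sup>2 + A) ^ 3 - A ^ 3\<close> an integer.\<close>
  define d where "d = A ^ 3"
  have d: "d \<in> \<int>" "d * \<delta>\<^sup>2 \<in> \<int>"
  proof -
    show "d \<in> \<int>" by (simp add: d_def A_def)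
    have "d * \<delta>\<^sup>2 = (A * s) ^ 3 - A ^ 3" unfolding d_def \<delta>2 by (simp add: power_mult_distrib algebra_simps)
    also have "\<dots> = (T\<^sup>2 + A) ^ 3 - A ^ 3" by (simp only: sA(2))
    also have "\<dots> \<in> \<int>" unfolding A_def T_def by (intro Ints_diff Ints_power Ints_add Ints_of_nat)
    finally show "d * \<delta>\<^sup>2 \<in> \<int>" .
  qed
  define F where "F = (\<lambda>n. tan_series (1 / 3) n y)"
  define m where "m = F 1 / (3 * F 0)"
  have Fb: "F 0 \<ge> 9 / 10" "F 0 \<le> 11 / 10" "F 1 \<ge> 9 / 10" "F 1 \<le> 11 / 10"
    using tan_series_01_bounds[of y] yb unfolding F_def by auto
  have m: "0 < m" "m < 1" using Fb by (simp_all add: m_def)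
  have "s ^ 3 * (1 - 3 * m) = (1 - m) ^ 3"
    using tan_third_cubic[OF \<delta> \<delta>2] Fb unfolding y\<delta> m_def F_def by simp
  then have x: "x = T * s / (s - 1 + m)"
    using assms(4,5) unfolding A_def[symmetric] T_def[symmetric] by (intro cubic_root_param[OF AT sA(1) m])
  have x_pos: "x > 0" and x_le: "x \<le> 10 / 9 * T"
  proof -
    show "x > 0" unfolding x using s m AT by (intro divide_pos_pos mult_pos_pos) auto
    \<comment> \<open>\<open>s \<ge> 10\<close> gives
      \<open>s \<le> 10 / 9 * (s - 1)\<close>.\<close>
    have "T * s \<le> T * (10 / 9 * (s - 1 + m))" using s m AT by (intro mult_left_mono) auto
    then show "x \<le> 10 / 9 * T" unfolding x using s m by (subst pos_divide_le_eq) (simp_all only: mult_ac)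
  qed
  have Ts: "T * s = x * (s - 1 + m)" unfolding x using s m by simp
  define N where "N = (\<lambda>j::nat. 3 * (27 * d) ^ j)"
  define \<rho> where "\<rho> = (\<lambda>j::nat. conv_re (1 / 3) \<delta> (2 * j + 1) / \<delta>)"
  define \<iota> where "\<iota> = (\<lambda>j::nat. conv_im (1 / 3) \<delta> (2 * j + 1))"
  have N: "N j > 0" for j using AT by (simp add: N_def d_def)
  have \<rho>0: "\<rho> j \<ge> 0" and \<iota>0: "\<iota> j \<ge> 0" for j
    unfolding \<rho>_def \<iota>_def using \<delta> conv_re_nonneg[of "1 / 3" \<delta>] conv_im_nonneg[of "1 / 3" \<delta>] by simp_all
  have \<iota>_le: "\<iota> j \<le> \<rho> j / 3" for j
    using conv_im_le[of "1 / 3" \<delta> "2 * j + 1"] \<delta> unfolding \<rho>_def \<iota>_def by simp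
  define Qr where "Qr = (\<lambda>j. N j * (T\<^sup>2 * \<rho> j + A * \<iota> j))"
  define Pr where "Pr = (\<lambda>j. N j * (T * (T\<^sup>2 + A) * \<rho> j))"
  have ints: "Qr j \<in> \<int>" "Pr j \<in> \<int>" for j
  proof -
    have 1: "N j * \<rho> j \<in> \<int>" "N j * \<iota> j \<in> \<int>"
      using conv_third_integral[OF d, of j] \<delta> unfolding N_def \<rho>_def \<iota>_def by simp_all
    have 2: "A \<in> \<int>" "T \<in> \<int>" by (simp_all add: A_def T_def)
    have "T\<^sup>2 * (N j * \<rho> j) + A * (N j * \<iota> j) \<in> \<int>" "T * (T\<^sup>2 + A) * (N j * \<rho> j) \<in> \<int>"
      by (intro Ints_add Ints_mult Ints_power 1 2)+
    then show "Qr j \<in> \<int>" "Pr j \<in> \<int>" unfolding Qr_def Pr_def by (simp_all add: algebra_simps)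
  qed
  define P Q where "P = (\<lambda>j. \<lfloor>Pr j\<rfloor>)" and "Q = (\<lambda>j. \<lfloor>Qr j\<rfloor>)"
  have PQ: "of_int (P j) = Pr j" "of_int (Q j) = Qr j" for j
    unfolding P_def Q_def using ints[of j] by (auto elim!: Ints_cases)
  show thesis
  proof
    fix j
    have "Qr j \<ge> 0" unfolding Qr_def using N[of j] \<rho>0[of j] \<iota>0[of j] AT by simp
    then show "0 \<le> Q j" by (simp add: Q_def)
    have "Qr j \<le> N j * (T\<^sup>2 * \<rho> j + A * (\<rho> j / 3))"
      unfolding Qr_def using N[of j] AT \<iota>_le[of j] by (intro mult_left_mono add_left_mono) auto
    also have "\<dots> = (3 * T\<^sup>2 + A) * ((27 * d) ^ j * \<rho> j)" by (simp add: N_def algebra_simps)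
    \<comment> \<open>The odd power \<open>2 * j + 1\<close> leaves one factor
      \<open>4 * sqrt (s ^ 3) \<le> 8 * \<delta>\<close>; dividing by \<open>\<delta>\<close> leaves
      8.\<close>
    also have "\<dots> \<le> (3 * T\<^sup>2 + A) * ((27 * d) ^ j * (8 * (16 * s ^ 3) ^ j))"
    proof (intro mult_left_mono)
      let ?r = "sqrt (s ^ 3)"
      have r2: "?r\<^sup>2 = s ^ 3" using s by simp
      have "s ^ 3 \<le> (2 * \<delta>)\<^sup>2" using s3 by (simp add: power_mult_distrib \<delta>2)
      then have "?r \<le> 2 * \<delta>" using \<delta> by (intro real_le_lsqrt) auto
      have "conv_re (1 / 3) \<delta> (2 * j + 1) \<le> (4 * ?r) ^ (2 * j + 1)"
        using conv_re_le[of "1 / 3" \<delta> "2 * j + 1"] \<delta> by (simp add: \<delta>2)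
      also have "\<dots> = (16 * s ^ 3) ^ j * (4 * ?r)"
        by (simp add: power_mult power_mult_distrib r2)
      also have "\<dots> \<le> (16 * s ^ 3) ^ j * (8 * \<delta>)"
        using \<open>?r \<le> 2 * \<delta>\<close> s by (intro mult_left_mono) auto
      finally show "\<rho> j \<le> 8 * (16 * s ^ 3) ^ j" unfolding \<rho>_def using \<delta> by (simp add: field_simps)
    qed (use AT in \<open>auto simp: d_def\<close>)
    also have "\<dots> = 8 * (3 * T\<^sup>2 + A) * ((27 * d) * (16 * s ^ 3)) ^ j"
      unfolding power_mult_distrib[of "27 * d" "16 * s ^ 3"] by (simp only: mult_ac)
    also have "(27 * d) * (16 * s ^ 3) = 432 * (T\<^sup>2 + A) ^ 3" unfolding sA(2) d_def by (simp add: power_mult_distrib)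
    finally show "real_of_int (Q j) \<le> 8 * (3 * (real t)\<^sup>2 + real a) * (432 * ((real t)\<^sup>2 + real a) ^ 3) ^ j"
      unfolding PQ A_def T_def .
    \<comment> \<open>Since \<open>T * s = x * (s - 1 + m)\<close>, the terms with
      \<open>(s - 1) * \<rho> j\<close> cancel, and only the error of
      \<open>\<iota> j / \<rho> j\<close> against \<open>m\<close> survives.\<close>
    have "Qr j * x - Pr j = N j * A * x * (\<iota> j - m * \<rho> j)"
    proof -
      have "Pr j = N j * (A * \<rho> j * (T * s))" unfolding Pr_def sA(2) by simp
      then show ?thesis unfolding Qr_def Ts sA(1) by (simp add: algebra_simps)
    qed
    moreover have "\<bar>\<iota> j - m * \<rho> j\<bar> \<le> 1 / 2 * (y ^ Suc j / (1 - y) ^ (2 * j + 3))"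
    proof -
      let ?g = "remainder_coeff (1 / 3) (2 * j + 1)"
      have "Suc (2 * j + 1) = 2 * Suc j" by simp
      then have "\<delta> ^ Suc (2 * j + 1) = (\<delta>\<^sup>2) ^ Suc j" by (simp only: power_mult)
      then have dy: "?g / \<delta> ^ Suc (2 * j + 1) = ?g * y ^ Suc j"
        unfolding y\<delta>[symmetric] power_divide by simp
      have F_eq: "tan_series (1 / 3) n y = F n" for n by (simp add: F_def)
      have F1: "(1 / 3) / \<delta> * F 1 * conv_re (1 / 3) \<delta> (2 * j + 1) = F 0 * (m * \<rho> j)"
        unfolding m_def \<rho>_def using Fb by simp
      have "\<bar>1 / 3 :: real\<bar> < 1" by simp
      from remainder_eq[OF this \<delta>, of "2 * j + 1"]
      have "F 0 * (m * \<rho> j) - F 0 * \<iota> j = ?g * y ^ Suc j * F (Suc (2 * j + 1))"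
        unfolding y\<delta> dy F_eq F1 \<iota>_def .
      then have "F 0 * \<bar>\<iota> j - m * \<rho> j\<bar> = \<bar>?g * y ^ Suc j * F (Suc (2 * j + 1))\<bar>"
        using Fb by (metis abs_minus_commute abs_mult abs_of_nonneg order_trans right_diff_distrib zero_le_divide_iff zero_le_numeral)
      also have "\<dots> = \<bar>?g\<bar> * y ^ Suc j * \<bar>F (Suc (2 * j + 1))\<bar>"
        using yb by (simp add: abs_mult)
      also have "\<dots> \<le> 1 / 3 * y ^ Suc j * (1 / (1 - y) ^ (2 * j + 3))"
      proof (intro mult_mono)
        show "\<bar>?g\<bar> \<le> 1 / 3" using abs_remainder_coeff_le[of "1 / 3" "2 * j + 1"] by simp
        have "Suc (2 * j + 1) + 1 = 2 * j + 3" by simp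
        then show "\<bar>F (Suc (2 * j + 1))\<bar> \<le> 1 / (1 - y) ^ (2 * j + 3)"
          using abs_tan_series_le[of "1 / 3" y "Suc (2 * j + 1)"] yb unfolding F_def by (simp only:)
      qed (use yb in auto)
      finally have "F 0 * \<bar>\<iota> j - m * \<rho> j\<bar> \<le> 1 / 3 * (y ^ Suc j / (1 - y) ^ (2 * j + 3))" by simp
      \<comment> \<open>The crude bound \<open>F 0 \<ge> 2 / 3\<close> turns the constant
        \<open>1 / 3\<close> into \<open>1 / 2\<close>.\<close>
      moreover have "2 / 3 * \<bar>\<iota> j - m * \<rho> j\<bar> \<le> F 0 * \<bar>\<iota> j - m * \<rho> j\<bar>"
        using Fb by (intro mult_right_mono) auto
      ultimately have "2 / 3 * \<bar>\<iota> j - m * \<rho> j\<bar> \<le> 1 / 3 * (y ^ Suc j / (1 - y) ^ (2 * j + 3))"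
        by (rule order_trans[rotated])
      from mult_left_mono[OF this, of "3 / 2"] show ?thesis by (simp only: mult.assoc[symmetric]) simp
    qed
    ultimately have "\<bar>Qr j * x - Pr j\<bar> \<le> N j * A * x * (1 / 2 * (y ^ Suc j / (1 - y) ^ (2 * j + 3)))"
      using N[of j] AT x_pos by (simp only: abs_mult) (intro mult_mono, auto)
    also have "\<dots> = 3 / 2 * A * x * (y / (1 - y) ^ 3) * (27 * A ^ 3 * (y / (1 - y)\<^sup>2)) ^ j"
    proof -
      have "3 * (27 * e) ^ j * A * x * (1 / 2 * (z * z ^ j / (p ^ j * c))) = 3 / 2 * A * x * (z / c) * (27 * e * (z / p)) ^ j"
        for e z p c :: real by (simp add: power_mult_distrib power_divide mult_ac)
      then show ?thesis unfolding N_def d_def power_add power_mult power_Suc by (simp only: power_Suc)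
    qed
    \<comment> \<open>The constants multiply to
      \<open>3 / 2 * (10 / 9) * (6 / 5) = 2\<close>.\<close>
    also have "\<dots> \<le> 3 / 2 * A * (10 / 9 * T) * (6 / 5 / s ^ 3) * (27 * A ^ 3 * (y / (1 - y)\<^sup>2)) ^ j"
      using inverse_over_cube_le[OF s y_def[THEN meta_eq_to_obj_eq]] x_le x_pos AT yb s
      by (intro mult_right_mono mult_mono) auto
    also have "\<dots> = 2 * A * T / s ^ 3 * (27 * A ^ 3 * (y / (1 - y)\<^sup>2)) ^ j" by simp
    finally show "\<bar>of_int (Q j) * x - of_int (P j)\<bar> \<le>
       2 * real a * real t / s ^ 3 * (27 * real a ^ 3 * (y / (1 - y)\<^sup>2)) ^ j"
      unfolding PQ A_def T_def .
    \<comment> \<open>The determinant reduces to that of \<open>conv_re\<close> and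
      \<open>conv_im\<close> at the indices \<open>2 * j + 1\<close> and
      \<open>2 * j + 3\<close>.\<close>
    have "Qr j * Pr (Suc j) - Qr (Suc j) * Pr j =
      N j * N (Suc j) * T * (T\<^sup>2 + A) * A * (\<iota> j * \<rho> (Suc j) - \<iota> (Suc j) * \<rho> j)"
      unfolding Qr_def Pr_def by (simp add: algebra_simps)
    moreover have "\<iota> j * \<rho> (Suc j) - \<iota> (Suc j) * \<rho> j \<noteq> 0"
    proof -
      have "\<iota> j * \<rho> (Suc j) - \<iota> (Suc j) * \<rho> j = - (conv_re (1 / 3) \<delta> (2 * j + 1) * conv_im (1 / 3) \<delta> (2 * j + 1 + 2) -
          conv_re (1 / 3) \<delta> (2 * j + 1 + 2) * conv_im (1 / 3) \<delta> (2 * j + 1)) / \<delta>"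
        unfolding \<iota>_def \<rho>_def by (simp add: diff_divide_distrib mult.commute)
      then show ?thesis using conv_det2[of "1 / 3" \<delta> "2 * j + 1"] \<delta> by simp
    qed
    moreover have "T\<^sup>2 + A > 0" using AT by (simp add: add_nonneg_pos)
    ultimately have "Qr j * Pr (Suc j) - Qr (Suc j) * Pr j \<noteq> 0"
      using N[of j] N[of "Suc j"] AT by (metis less_irrefl no_zero_divisors)
    then have "of_int (Q j * P (Suc j)) \<noteq> (of_int (Q (Suc j) * P j) :: real)"
      unfolding of_int_mult PQ by simp
    then show "Q j * P (Suc j) \<noteq> Q (Suc j) * P j" by metis
  qed
qed

text \<open>With \<open>u = t\<^sup>2\<close>, the bound \<open>key\<close> for
  \<open>(u + a) ^ 3\<close> brings in the denominators of \<open>tau4\<close>. The numerical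
  constants leave room for the factor 40, as \<open>105 * 10 / 4 / 40 > 6\<close>; it later makes
  the scaled error at most \<open>1 / 80\<close>.\<close>

lemma error_constant_le:
  assumes "a > 0" "t > 0"
  defines "s \<equiv> (t\<^sup>2 + a) / a"
  shows "2 * a * t / s ^ 3 \<le> tau4 a t / 40"
proof -
  define u where "u = t\<^sup>2"
  have u: "u > 0" using assms by (simp add: u_def)
  have pos: "u + a > 0" "u + 2 * a > 0" "3 * u + a > 0" using u assms by simp_all
  have "sqrt 3 \<ge> 17 / 10" by (rule real_le_rsqrt) (simp add: power2_eq_square)
  moreover have "(exp 1)\<^sup>2 \<ge> (6 :: real)"
  proof -
    have "(5 / 2)\<^sup>2 \<le> (exp (1::real))\<^sup>2"
      using exp_lower_Taylor_quadratic[of "1::real"] by (intro power_mono) auto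
    then show ?thesis by (simp add: power2_eq_square)
  qed
  ultimately have "17 / 10 * 6 \<le> sqrt 3 * (exp 1)\<^sup>2" by (intro mult_mono) auto
  then have 1: "105 * 10 \<le> 105 * sqrt 3 * (exp 1)\<^sup>2" by simp
  have "sqrt pi \<le> 2" using pi_less_4 by (intro real_le_lsqrt) auto
  then have 2: "2 * sqrt pi \<le> 4" by simp
  have key: "u * (u + 2 * a) * (3 * u + a) \<le> 3 * (u + a) ^ 3"
  proof -
    have "3 * (u + a) ^ 3 - u * (u + 2 * a) * (3 * u + a) = 2 * u\<^sup>2 * a + 7 * u * a\<^sup>2 + 3 * a ^ 3"
      by algebra
    moreover have "\<dots> \<ge> 0" using u assms by simp
    ultimately show ?thesis by linarith
  qed
  have "2 * a * t / s ^ 3 = 2 * a ^ 4 * t / (u + a) ^ 3"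
    using assms unfolding s_def u_def by (simp add: power_divide power3_eq_cube power4_eq_xxxx)
  also have "\<dots> \<le> 2 * a ^ 4 * t / (u * (u + 2 * a) * (3 * u + a) / 3)"
    using key pos u assms by (intro divide_left_mono mult_pos_pos) auto
  also have "\<dots> = 6 * a ^ 4 / (t * (u + 2 * a) * (3 * u + a))"
    using assms unfolding u_def by (simp add: power2_eq_square)
  also have "\<dots> \<le> (105 * 10 / 4) / 40 * (a ^ 4 / (t * (u + 2 * a) * (3 * u + a)))"
  proof -
    define k where "k = a ^ 4 / (t * (u + 2 * a) * (3 * u + a))"
    have "k \<ge> 0" using pos assms by (simp add: k_def)
    then have "6 * k \<le> (105 * 10 / 4) / 40 * k" by simp
    then show ?thesis by (simp only: k_def times_divide_eq_right)
  qed
  also have "\<dots> \<le> (105 * sqrt 3 * (exp 1)\<^sup>2 / (2 * sqrt pi)) / 40 * (a ^ 4 / (t * (u + 2 * a) * (3 * u + a)))"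
    using 1 2 pos assms pi_gt_zero by (intro mult_right_mono divide_right_mono frac_le) auto
  also have "\<dots> = tau4 a t / 40" unfolding tau4_def u_def by (simp add: mult_ac)
  finally show ?thesis .
qed

section \<open>From two consecutive approximations to the lower bound\<close>

theorem theorem1:
  fixes a t q :: nat and x :: real
  assumes "a > 0" and "t > 0" and "t\<^sup>2 \<ge> 9 * a"
    and "3 * x ^ 3 - 3 * real t * x\<^sup>2 - 3 * real a * x + real a * real t = 0"
    and "x > real t / 2"
    and "c7 a t > exp 1"
    and "q > 0" and "real q \<ge> c7 a t / (2 * tau4 a t)"
  shows "dist_nearest_int (real q * x) >
    ln (c7 a t) powr (1 / 2)
      / (6 * tau3 a t * (c6 a t)\<^sup>2 * (2 * tau4 a t) powr (ln (c6 a t) / ln (c7 a t)))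
    * real q powr (- (ln (c6 a t) / ln (c7 a t)))
    * ln (2 * tau4 a t * real q) powr (- (ln (c6 a t) / ln (c7 a t)) - 1 / 2)"
proof -
  define A T where "A = real a" and "T = real t"
  define s where "s = (T\<^sup>2 + A) / A"
  define y where "y = 1 / (s ^ 3 - 1)"
  define C6 C7 \<tau>3 \<tau>4 where "C6 = c6 A T" and "C7 = c7 A T" and "\<tau>3 = tau3 A T" and "\<tau>4 = tau4 A T"
  define \<mu> where "\<mu> = ln C6 / ln C7"
  define M where "M = 2 * \<tau>4 * real q"
  have AT: "A \<ge> 1" "T \<ge> 1" using assms by (simp_all add: A_def T_def)
  have T2: "T\<^sup>2 \<ge> 9 * A"
    using assms(3) unfolding A_def T_def by (metis of_nat_le_iff of_nat_mult of_nat_numeral of_nat_power)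
  have s: "s \<ge> 10" using T2 AT unfolding s_def by (simp add: field_simps)
  have sA: "T\<^sup>2 = A * (s - 1)" "T\<^sup>2 + A = A * s" "T\<^sup>2 + 2 * A = A * (s + 1)"
    using AT unfolding s_def by (simp_all add: field_simps)
  have \<tau>3: "\<tau>3 = 4 * (3 * T\<^sup>2 + A) / sqrt pi" by (simp add: \<tau>3_def tau3_def)
  have "T\<^sup>2 > 0" using AT by simp
  then have \<tau>4: "\<tau>4 > 0" using AT unfolding \<tau>4_def tau4_def
    by (intro divide_pos_pos mult_pos_pos add_pos_pos) auto
  have "T\<^sup>2 + A \<ge> 1" using AT zero_le_power2[of T] by linarith
  then have "(T\<^sup>2 + A) ^ 3 \<ge> 1" by (rule one_le_power)
  then have C6: "432 * (T\<^sup>2 + A) ^ 3 \<le> C6" "C6 > 1"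
    using c6_ge[of A T] AT unfolding C6_def by simp_all
  have C7: "C7 > exp 1" using assms(6) unfolding C7_def A_def T_def .
  have C7_0: "C7 > 0" using C7 exp_gt_zero[of 1] by linarith
  have L7: "ln C7 > 1" using C7 C7_0 by (metis exp_gt_zero ln_exp ln_less_cancel_iff)
  have L6: "ln C6 > 0" using C6 by simp
  have MC: "M \<ge> C7"
    using assms(8) \<tau>4 unfolding M_def C7_def \<tau>4_def A_def[symmetric] T_def[symmetric] by (simp add: field_simps)
  have M0: "M > 0" using MC C7_0 by linarith
  have LM: "ln M \<ge> ln C7" using MC C7_0 by simp
  have q0: "real q > 0" using assms(7) by simp

  \<comment> \<open>With this index \<open>C7 ^ j0 \<le> M \<le> C7 ^ Suc j0\<close>: the upper
    bound makes the error small, the lower one keeps \<open>C6 ^ j0\<close> below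
    \<open>M powr \<mu>\<close>.\<close>
  define j0 where "j0 = nat \<lfloor>ln M / ln C7\<rfloor>"
  have "ln M / ln C7 \<ge> 0" using LM L7 by simp
  then have j0: "real j0 \<le> ln M / ln C7" "ln M / ln C7 < real (Suc j0)"
    unfolding j0_def by linarith+
  have MJ: "M \<le> C7 ^ Suc j0"
  proof -
    have "ln M \<le> real (Suc j0) * ln C7" using j0(2) L7 by (simp add: field_simps)
    then have "exp (ln M) \<le> exp (real (Suc j0) * ln C7)" by (simp only: exp_le_cancel_iff)
    then have "M \<le> exp (real (Suc j0) * ln C7)" using M0 by simp
    also have "\<dots> = C7 ^ Suc j0" unfolding exp_of_nat_mult using C7_0 by simp
    finally show ?thesis .
  qed

  \<comment> \<open>Each step of \<open>j\<close> shrinks the error at least by the factor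
    \<open>C7\<close>.\<close>
  have rate: "27 * A ^ 3 * (y / (1 - y)\<^sup>2) * C7 \<le> 1"
  proof -
    let ?Y = "27 * A ^ 3 * (y / (1 - y)\<^sup>2)"
    have "?Y \<ge> 0" using inverse_bounds[OF s y_def] AT by simp
    then have "?Y * C7 \<le> ?Y * (T ^ 4 * (T\<^sup>2 + 2 * A)\<^sup>2 / (27 * A ^ 6 * (T\<^sup>2 + A)))"
      unfolding C7_def using AT by (intro mult_left_mono c7_le) auto
    also have "T ^ 4 = (T\<^sup>2)\<^sup>2" by simp
    also have "?Y * ((T\<^sup>2)\<^sup>2 * (T\<^sup>2 + 2 * A)\<^sup>2 / (27 * A ^ 6 * (T\<^sup>2 + A))) =
        (s\<^sup>2 - 1)\<^sup>2 / s * (y / (1 - y)\<^sup>2)"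
    proof -
      have 1: "(A * (s - 1))\<^sup>2 * (A * (s + 1))\<^sup>2 = A ^ 4 * (s\<^sup>2 - 1)\<^sup>2" by algebra
      have 2: "27 * A ^ 6 * (A * s) = A ^ 4 * (27 * A ^ 3 * s)" by algebra
      have "(T\<^sup>2)\<^sup>2 * (T\<^sup>2 + 2 * A)\<^sup>2 / (27 * A ^ 6 * (T\<^sup>2 + A)) = (s\<^sup>2 - 1)\<^sup>2 / (27 * A ^ 3 * s)"
        unfolding sA(2,3) unfolding sA(1) 1 2 using AT by simp
      then show ?thesis using AT by (simp add: mult_ac)
    qed
    also have "\<dots> \<le> 1" by (rule inverse_over_square_le[OF s y_def])
    finally show ?thesis .
  qed

  obtain P Q :: "nat \<Rightarrow> int" where
    Q0: "\<And>j. 0 \<le> Q j" and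
    Q_le: "\<And>j. real_of_int (Q j) \<le> 8 * (3 * T\<^sup>2 + A) * (432 * (T\<^sup>2 + A) ^ 3) ^ j" and
    err: "\<And>j. \<bar>of_int (Q j) * x - of_int (P j)\<bar> \<le> 2 * A * T / s ^ 3 * (27 * A ^ 3 * (y / (1 - y)\<^sup>2)) ^ j" and
    det: "\<And>j. Q j * P (Suc j) \<noteq> Q (Suc j) * P j"
    by (rule approximants[OF assms(1-5), folded A_def T_def, folded s_def, folded y_def]) (rule that)

  define p where "p = round (real q * x)"
  \<comment> \<open>If \<open>p / q\<close> agreed with both approximations, their determinant would
    vanish.\<close>
  have "\<exists>j\<in>{Suc j0, Suc (Suc j0)}. int q * P j \<noteq> p * Q j"
  proof (rule ccontr)
    assume "\<not> ?thesis"
    then have "int q * P (Suc j0) = p * Q (Suc j0)" "int q * P (Suc (Suc j0)) = p * Q (Suc (Suc j0))" by auto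
    then have "int q * (Q (Suc j0) * P (Suc (Suc j0))) = int q * (Q (Suc (Suc j0)) * P (Suc j0))" by algebra
    then show False using det[of "Suc j0"] assms(7) by simp
  qed
  then obtain j where j: "j \<in> {Suc j0, Suc (Suc j0)}" "int q * P j \<noteq> p * Q j" by blast

  \<comment> \<open>The error constant times \<open>q\<close> is at most \<open>M / 80\<close>, and
    \<open>M \<le> C7 ^ j\<close> is absorbed by \<open>rate\<close>.\<close>
  have small: "real q * \<bar>of_int (Q j) * x - of_int (P j)\<bar> \<le> 1 / 80"
  proof -
    let ?Y = "27 * A ^ 3 * (y / (1 - y)\<^sup>2)"
    have Y: "?Y \<ge> 0" using inverse_bounds[OF s y_def] AT by simp
    have "M \<le> C7 ^ j"
    proof -
      have "C7 \<ge> 1" using C7 exp_ge_add_one_self[of 1] by linarith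
      then have "C7 ^ Suc j0 \<le> C7 ^ j" using j(1) by (intro power_increasing) auto
      then show ?thesis using MJ by linarith
    qed
    have "real q * \<bar>of_int (Q j) * x - of_int (P j)\<bar> \<le> real q * (2 * A * T / s ^ 3 * ?Y ^ j)"
      using err by (intro mult_left_mono) auto
    also have "\<dots> \<le> real q * (\<tau>4 / 40 * ?Y ^ j)"
      using error_constant_le[of A T] AT Y unfolding s_def[symmetric] \<tau>4_def
      by (intro mult_left_mono mult_right_mono) auto
    also have "\<dots> = 1 / 80 * (M * ?Y ^ j)" by (simp add: M_def)
    also have "\<dots> \<le> 1 / 80 * (C7 ^ j * ?Y ^ j)"
      using \<open>M \<le> C7 ^ j\<close> Y by (intro mult_left_mono mult_right_mono) auto
    also have "\<dots> = 1 / 80 * (?Y * C7) ^ j" by (simp only: power_mult_distrib mult.commute)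
    also have "\<dots> \<le> 1 / 80 * 1"
      using rate mult_nonneg_nonneg[OF Y less_imp_le[OF C7_0]] by (intro mult_left_mono power_le_one) auto
    finally show ?thesis by simp
  qed

  let ?d = "dist_nearest_int (real q * x)"
  have d: "?d = \<bar>real q * x - of_int p\<bar>" by (simp add: dist_nearest_int_def p_def)
  \<comment> \<open>A nonzero integer has absolute value at least 1; it splits into
    \<open>Q j\<close> times the distance and the small error, so the first part is at least
    \<open>79 / 80\<close>.\<close>
  have "1 \<le> \<bar>int q * P j - p * Q j\<bar>" using j(2) by simp
  then have "1 \<le> \<bar>real q * of_int (P j) - of_int p * of_int (Q j)\<bar>"
    by (metis (mono_tags) of_int_1_le_iff of_int_abs of_int_diff of_int_mult of_int_of_nat_eq)
  also have "real q * of_int (P j) - of_int p * of_int (Q j) =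
      of_int (Q j) * (real q * x - of_int p) - real q * (of_int (Q j) * x - of_int (P j))" by algebra
  also have "\<bar>\<dots>\<bar> \<le> of_int (Q j) * ?d + real q * \<bar>of_int (Q j) * x - of_int (P j)\<bar>"
    unfolding d using Q0[of j] by (intro order_trans[OF abs_triangle_ineq4]) (simp add: abs_mult)
  also have "\<dots> \<le> of_int (Q j) * ?d + 1 / 80" using small by simp
  finally have "79 / 80 \<le> of_int (Q j) * ?d" by simp
  also have "\<dots> \<le> (8 * (3 * T\<^sup>2 + A) * C6 ^ Suc (Suc j0)) * ?d"
  proof (intro mult_right_mono)
    \<comment> \<open>Since \<open>j \<le> j0 + 2\<close>, the loss against \<open>C6 ^ j0\<close>
      is the factor \<open>C6\<^sup>2\<close> of the claimed bound.\<close>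
    have "(432 * (T\<^sup>2 + A) ^ 3) ^ j \<le> C6 ^ j" using C6 AT by (intro power_mono) auto
    also have "\<dots> \<le> C6 ^ Suc (Suc j0)" using C6 j(1) by (intro power_increasing) auto
    finally have "8 * (3 * T\<^sup>2 + A) * (432 * (T\<^sup>2 + A) ^ 3) ^ j \<le> 8 * (3 * T\<^sup>2 + A) * C6 ^ Suc (Suc j0)"
      using AT by (intro mult_left_mono) auto
    then show "real_of_int (Q j) \<le> 8 * (3 * T\<^sup>2 + A) * C6 ^ Suc (Suc j0)" using Q_le[of j] by linarith
  qed (simp add: d)
  finally have lower: "79 / 80 \<le> 8 * (3 * T\<^sup>2 + A) * C6 ^ Suc (Suc j0) * ?d" .

  \<comment> \<open>Regrouping isolates two logarithmic factors that are at most 1, because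
    \<open>ln C7 \<le> ln M\<close> and \<open>ln M \<ge> 1\<close>.\<close>
  have "ln C7 powr (1 / 2) / (6 * \<tau>3 * C6\<^sup>2 * (2 * \<tau>4) powr \<mu>) * real q powr (- \<mu>) * ln M powr (- \<mu> - 1 / 2)
    = (ln C7 powr (1 / 2) / ln M powr (1 / 2)) * (1 / ln M powr \<mu>) * (1 / (6 * \<tau>3 * C6\<^sup>2 * M powr \<mu>))"
  proof -
    have 1: "ln M powr (- \<mu> - 1 / 2) = 1 / ln M powr \<mu> / ln M powr (1 / 2)"
      unfolding powr_diff powr_minus_divide ..
    have 2: "M powr \<mu> = (2 * \<tau>4) powr \<mu> * real q powr \<mu>"
      unfolding M_def by (rule powr_mult)
    have 3: "real q powr (- \<mu>) = 1 / real q powr \<mu>" by (rule powr_minus_divide)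
    show ?thesis unfolding 1 2 3 by (simp add: mult_ac)
  qed
  also have "\<dots> \<le> 1 * 1 * (1 / (6 * \<tau>3 * C6\<^sup>2 * C6 ^ j0))"
  proof (intro mult_mono)
    show "ln C7 powr (1 / 2) / ln M powr (1 / 2) \<le> 1"
      using LM L7 by (simp add: powr_mono2)
    have "\<mu> > 0" unfolding \<mu>_def using L6 L7 by simp
    then show "1 / ln M powr \<mu> \<le> 1" using LM L7 ge_one_powr_ge_zero[of "ln M" \<mu>] by simp
    have "C6 ^ j0 = exp (real j0 * ln C6)" unfolding exp_of_nat_mult using C6 by simp
    also have "\<dots> \<le> exp (ln M / ln C7 * ln C6)"
      using mult_right_mono[OF j0(1) less_imp_le[OF L6]] by (simp only: exp_le_cancel_iff)
    also have "\<dots> = M powr \<mu>" unfolding \<mu>_def powr_def using M0 by simp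
    finally have "C6 ^ j0 \<le> M powr \<mu>" .
    moreover have "\<tau>3 > 0" unfolding \<tau>3 using AT by (simp add: add_nonneg_pos)
    ultimately show "1 / (6 * \<tau>3 * C6\<^sup>2 * M powr \<mu>) \<le> 1 / (6 * \<tau>3 * C6\<^sup>2 * C6 ^ j0)"
      using C6 M0 by (intro divide_left_mono mult_left_mono mult_pos_pos) auto
    show "0 \<le> 1 / (6 * \<tau>3 * C6\<^sup>2 * M powr \<mu>)" using \<open>\<tau>3 > 0\<close> by simp
  qed auto
  also have "\<dots> = sqrt pi / (24 * ((3 * T\<^sup>2 + A) * C6 ^ Suc (Suc j0)))"
    unfolding \<tau>3 by (simp add: power2_eq_square)
  \<comment> \<open>\<open>lower\<close> gives \<open>24 * (?E * ?d) \<ge> 3 * 79 / 80 > 2\<close>,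
    while \<open>sqrt pi \<le> 2\<close>.\<close>
  also have "\<dots> < ?d"
  proof -
    let ?E = "(3 * T\<^sup>2 + A) * C6 ^ Suc (Suc j0)"
    have E: "?E > 0" using AT C6 by (intro mult_pos_pos add_nonneg_pos) auto
    have "sqrt pi \<le> 2" using pi_less_4 by (intro real_le_lsqrt) auto
    moreover have "79 / 80 \<le> 8 * (?E * ?d)" using lower by (simp only: mult.assoc)
    ultimately have "sqrt pi < 24 * (?E * ?d)" by linarith
    moreover have "24 * ?E > 0" by (rule mult_pos_pos[OF _ E]) simp
    ultimately show ?thesis by (simp only: pos_divide_less_eq mult_ac)
  qed
  finally show ?thesis
    unfolding \<mu>_def M_def C6_def C7_def \<tau>3_def \<tau>4_def A_def T_def .
qed

end
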